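(* Let $X$ and $Y$ be Banach spaces, $S\in\mathcal{L}(X,Y)$, $F\subset X$ convex and $n\in\mathbb{N}$. Then \[ e_{2n-1}^{\text{det-non}}(S,F)\;\le\;12\,n^{3/2}\Big(\prod_{k=0}^{n-1} e_k^{\text{ran}}(S,F)\Big)^{1/n}. \] Moreover: (a) if $F$ is additionally symmetric ($F=-F$), the factor $n^{3/2}$ can be replaced by $n$; (b) if $Y$ is a Hilbert space, $n^{3/2}$ can be replaced by $n$; (c) if $F$ is symmetric and $Y$ is a Hilbert space, $n^{3/2}$ can be replaced by $n^{1/2}$; (d) if $X$ is a Hilbert space and $F=B_X$ is its closed unit ball, then $e_{4n-1}^{\text{det-non}}(S,F)\le 12\,n^{1/2}\big(\prod_{k=0}^{n-1} e_k^{\text{ran}}(S,F)\big)^{1/n}$.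
   Context: $\mathcal{L}(X,Y)$ denotes bounded linear operators, $X'$ the dual of $X$, $B_X$ the closed unit ball. A deterministic adaptive algorithm with $n$ measurements is a map $A_n=\phi\circ N_n\colon F\to Y$ where $\phi\colon\mathbb{R}^n\to Y$ is arbitrary and $N_n(f)=(y_1,\dots,y_n)$ with $y_1=L_1(f)$ and $y_k=L_k^{(y_1,\dots,y_{k-1})}(f)$, where each $L_k^{(\cdot)}\in X'$ may depend arbitrarily on the previously observed values; it is non-adaptive if $L_1,\dots,L_n\in X'$ are fixed (the same for all $f$). (For $n=0$ the algorithm outputs a constant.) The worst-case error is $e(A_n,S,F)=\sup_{f\in F}\|S(f)-A_n(f)\|_Y$. A randomized algorithm is a family $(A_n^\omega)_{\omega\in\Omega}$ of deterministic adaptive algorithms indexed by a probability space $(\Omega,\mathcal{A},\mathbb{P})$ such that $(f,\omega)\mapsto\|S(f)-A_n^\omega(f)\|_Y$ is $\mathcal{B}_F\otimes\mathcal{A}$-measurable, where $\mathcal{B}_F$ is the Borel $\sigma$-algebra on $F$ of the seminorm whose unit ball is $F-F$; its error is $e(A_n,S,F)=\sup_{f\in F}\mathbb{E}\|S(f)-A_n^\omega(f)\|_Y$. The minimal errors $e_n^{\text{det-non}}(S,F)$ and $e_n^{\text{ran}}(S,F)$ are the infima of the error over all deterministic non-adaptive algorithms, respectively over all randomized (possibly adaptive) algorithms, with $n$ measurements. *)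

theory Defs
  imports "HOL-Probability.Probability"
begin

text \<open>Information of a (possibly adaptive) method: L k ys is the (k+1)-th
  functional, chosen after observing the values ys = (y_1,...,y_k).\<close>
primrec info :: "(nat \<Rightarrow> real list \<Rightarrow> 'a \<Rightarrow> real) \<Rightarrow> nat \<Rightarrow> 'a \<Rightarrow> real list" where
  "info L 0 f = []"
| "info L (Suc k) f = info L k f @ [L k (info L k f) f]"

definition adaptive_algs :: "nat \<Rightarrow> ('a::real_normed_vector \<Rightarrow> 'b) set" where
  "adaptive_algs n = {A. \<exists>(L :: nat \<Rightarrow> real list \<Rightarrow> 'a \<Rightarrow> real) (phi :: real list \<Rightarrow> 'b).
      (\<forall>k<n. \<forall>ys. length ys = k \<longrightarrow> bounded_linear (L k ys)) \<and>
      A = (\<lambda>f. phi (info L n f))}"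

definition nonadaptive_algs :: "nat \<Rightarrow> ('a::real_normed_vector \<Rightarrow> 'b) set" where
  "nonadaptive_algs n = {A. \<exists>(L :: nat \<Rightarrow> 'a \<Rightarrow> real) (phi :: real list \<Rightarrow> 'b).
      (\<forall>k<n. bounded_linear (L k)) \<and>
      A = (\<lambda>f. phi (map (\<lambda>k. L k f) [0..<n]))}"

definition det_err :: "('a \<Rightarrow> 'b::real_normed_vector) \<Rightarrow> 'a set \<Rightarrow> ('a \<Rightarrow> 'b) \<Rightarrow> ennreal" where
  "det_err S F A = (SUP f\<in>F. ennreal (norm (S f - A f)))"

text \<open>The seminorm whose unit ball is F - F (Minkowski functional; \<infinity> outside the span).\<close>
definition FF_seminorm :: "'a::real_vector set \<Rightarrow> 'a \<Rightarrow> ennreal" where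
  "FF_seminorm F x = (INF t \<in> {t::real. 0 < t \<and> x \<in> (\<lambda>z. t *\<^sub>R z) ` {a - b | a b. a \<in> F \<and> b \<in> F}}. ennreal t)"

text \<open>Borel sigma-algebra on F w.r.t. the topology induced by this seminorm.\<close>
definition BF :: "'a::real_vector set \<Rightarrow> 'a measure" where
  "BF F = sigma F {U. U \<subseteq> F \<and> (\<forall>f\<in>U. \<exists>r::real. 0 < r \<and>
                 {g \<in> F. FF_seminorm F (g - f) < ennreal r} \<subseteq> U)}"

definition ran_algs :: "('a::real_normed_vector \<Rightarrow> 'b::real_normed_vector) \<Rightarrow> 'a set \<Rightarrow> nat
    \<Rightarrow> ('c measure \<times> ('c \<Rightarrow> 'a \<Rightarrow> 'b)) set" where
  "ran_algs S F n = {(M, A). prob_space M \<and> (\<forall>\<omega>\<in>space M. A \<omega> \<in> adaptive_algs n) \<and>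
      (\<lambda>(f, \<omega>). norm (S f - A \<omega> f)) \<in> borel_measurable (BF F \<Otimes>\<^sub>M M)}"

definition ran_err :: "('a \<Rightarrow> 'b::real_normed_vector) \<Rightarrow> 'a set \<Rightarrow> 'c measure \<Rightarrow> ('c \<Rightarrow> 'a \<Rightarrow> 'b) \<Rightarrow> ennreal" where
  "ran_err S F M A = (SUP f\<in>F. \<integral>\<^sup>+ \<omega>. ennreal (norm (S f - A \<omega> f)) \<partial>M)"

definition e_det_non :: "nat \<Rightarrow> ('a::real_normed_vector \<Rightarrow> 'b::real_normed_vector) \<Rightarrow> 'a set \<Rightarrow> ennreal" where
  "e_det_non n S F = (INF A \<in> nonadaptive_algs n. det_err S F A)"

definition e_ran :: "'c itself \<Rightarrow> nat \<Rightarrow> ('a::real_normed_vector \<Rightarrow> 'b::real_normed_vector) \<Rightarrow> 'a set \<Rightarrow> ennreal" where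
  "e_ran (_::'c itself) n S F = (INF MA \<in> (ran_algs S F n :: ('c measure \<times> ('c \<Rightarrow> 'a \<Rightarrow> 'b)) set).
      ran_err S F (fst MA) (snd MA))"

definition enn_root :: "nat \<Rightarrow> ennreal \<Rightarrow> ennreal" where
  "enn_root n x = (if x = \<top> then \<top> else ennreal (root n (enn2real x)))"

end

theory Submission
  imports Defs "Jordan_Normal_Form.Determinant"
begin

text \<open>
  Write \<open>N = 2n\<close>. If every non-adaptive method with \<open>2n - 1\<close> functionals has error above \<open>2c\<close>, one can
  choose greedily half-differences \<open>d\<^sub>0, \<dots>, d\<^bsub>N-1\<^esub>\<close> of elements of \<open>F\<close> and functionals
  \<open>\<lambda>\<^sub>i\<close> norming \<open>S d\<^sub>i\<close> with \<open>\<lambda>\<^sub>i (S d\<^sub>j) = 0\<close> for \<open>i < j\<close> and \<open>\<lambda>\<^sub>i (S d\<^sub>i) > c\<close>;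
  spending a second functional per step makes the \<open>d\<^sub>j\<close> orthogonal when \<open>X\<close> is a Hilbert space.
  The triangular matrix \<open>(\<lambda>\<^sub>i (S d\<^sub>j))\<close> has determinant at least \<open>c\<^sup>N\<close>, hence so has the product of its
  singular values \<open>\<sigma>\<^sub>0 \<ge> \<dots> \<ge> \<sigma>\<^bsub>N-1\<^esub>\<close>, and \<open>\<Prod>k<n. \<sigma>\<^bsub>2k\<^esub>\<close> is at least \<open>c\<^sup>n\<close>.

  On the other hand, the span of the first \<open>2k + 1\<close> singular vectors carries a Euclidean ball inside \<open>F\<close>
  (of radius \<open>1/N\<close>, \<open>1/\<surd>N\<close> or \<open>1\<close>, depending on the case) on which \<open>S\<close> expands distances by \<open>\<sigma>\<^bsub>2k\<^esub>\<close>
  up to a factor \<open>\<surd>N\<close> or \<open>1\<close>. Average over a thin spherical shell: by rotation invariance, \<open>k\<close> adaptive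
  measurements leave at least the expected length of a projection to \<open>k + 1\<close> of the \<open>2k + 1\<close>
  coordinates, which exceeds \<open>12/25\<close>. So \<open>e\<^sub>k\<close> is bounded below by \<open>12/25 \<sigma>\<^bsub>2k\<^esub>\<close> times these
  factors, and the claim follows by taking the product over \<open>k < n\<close>.
\<close>

subsection \<open>Norming functionals\<close>

text \<open>Homogeneity is asked for as an inequality with positive factors only, which is easy to
  verify for infima; equality and the value 0 at 0 follow.\<close>

definition sublinear :: "('a::real_vector \<Rightarrow> real) \<Rightarrow> bool" where
  "sublinear q \<longleftrightarrow> (\<forall>x y. q (x + y) \<le> q x + q y) \<and> (\<forall>t>0. \<forall>x. q (t *\<^sub>R x) \<le> t * q x)"

lemma sublinearI:
  assumes "\<And>x y. q (x + y) \<le> q x + q y" "\<And>t x. t > 0 \<Longrightarrow> q (t *\<^sub>R x) \<le> t * q x"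
  shows "sublinear q"
  using assms by (auto simp: sublinear_def)

lemma sublinear_zero: "sublinear q \<Longrightarrow> q 0 = 0"
proof -
  assume q: "sublinear q"
  have "q 0 \<le> q 0 + q 0" using q unfolding sublinear_def by (metis add_0)
  moreover have "\<forall>t>0. \<forall>x. q (t *\<^sub>R x) \<le> t * q x" using q by (simp add: sublinear_def)
  from this[rule_format, of "1/2" 0] have "q 0 \<le> (1/2) * q 0" by simp
  ultimately show ?thesis by simp
qed

lemma sublinear_lower: "sublinear q \<Longrightarrow> - q (- x) \<le> q x"
proof -
  assume q: "sublinear q"
  then have "q (x + - x) \<le> q x + q (- x)" unfolding sublinear_def by blast
  then show ?thesis using sublinear_zero[OF q] by simp
qed

lemma sublinear_scale:
  assumes "sublinear q" "t \<ge> 0" shows "q (t *\<^sub>R x) = t * q x"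
proof (cases "t = 0")
  case True then show ?thesis using sublinear_zero[OF assms(1)] by simp
next
  case False
  then have t: "t > 0" using assms by simp
  have "q (inverse t *\<^sub>R (t *\<^sub>R x)) \<le> inverse t * q (t *\<^sub>R x)"
    using assms(1) t unfolding sublinear_def by (metis positive_imp_inverse_positive)
  then have "t * q x \<le> q (t *\<^sub>R x)" using t by (simp add: field_simps)
  moreover have "q (t *\<^sub>R x) \<le> t * q x" using assms(1) t unfolding sublinear_def by blast
  ultimately show ?thesis by simp
qed

text \<open>Serves twice: it forces a minimal sublinear functional to be additive, and applied to
  the norm it makes a dominated linear functional attain the norm at \<open>y\<close>.\<close>

lemma sublinear_tilt:
  fixes q :: "'a::real_vector \<Rightarrow> real"
  assumes q: "sublinear q"
  obtains r where "sublinear r" "\<And>x. r x \<le> q x" "\<And>x. r x \<le> q (x + y) - q y"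
proof -
  \<comment> \<open>The parameter \<open>t = 0\<close> gives \<open>r \<le> q\<close>,
    \<open>t = 1\<close> gives the tilted bound, and the infimum over the whole ray makes
    \<open>r\<close> sublinear.\<close>
  define r where "r x = (INF t\<in>{0..}. q (x + t *\<^sub>R y) - t * q y)" for x
  have add: "q (a + b) \<le> q a + q b" for a b using q by (simp add: sublinear_def)
  have bd: "- q (- x) \<le> q (x + t *\<^sub>R y) - t * q y" if "t \<ge> 0" for x t
    using add[of "x + t *\<^sub>R y" "- x"] sublinear_scale[OF q that, of y] by simp
  then have bdd: "bdd_below ((\<lambda>t. q (x + t *\<^sub>R y) - t * q y) ` {0..})" for x
    by (intro bdd_belowI2) auto
  have le: "r x \<le> q (x + t *\<^sub>R y) - t * q y" if "t \<ge> 0" for x t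
    unfolding r_def using that by (intro cINF_lower[OF bdd]) auto
  have ge: "c \<le> r x" if "\<And>t. t \<ge> 0 \<Longrightarrow> c \<le> q (x + t *\<^sub>R y) - t * q y" for c x
    unfolding r_def using that by (intro cINF_greatest) auto
  have "sublinear r"
  proof (rule sublinearI)
    fix x z
    have *: "r (x + z) \<le> (q (x + t *\<^sub>R y) - t * q y) + (q (z + s *\<^sub>R y) - s * q y)"
      if "t \<ge> 0" "s \<ge> 0" for t s
      using le[of "t + s" "x + z"] add[of "x + t *\<^sub>R y" "z + s *\<^sub>R y"] that
      by (simp add: algebra_simps)
    have "r (x + z) - (q (z + s *\<^sub>R y) - s * q y) \<le> r x" if "s \<ge> 0" for s
      by (rule ge) (use *[OF _ that] in \<open>simp add: algebra_simps\<close>)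
    then have "r (x + z) - r x \<le> r z" by (intro ge) (simp add: algebra_simps)
    then show "r (x + z) \<le> r x + r z" by simp
  next
    fix s :: real and x assume s: "s > 0"
    have "r (s *\<^sub>R x) / s \<le> r x"
    proof (rule ge)
      fix t :: real assume t: "t \<ge> 0"
      have "r (s *\<^sub>R x) \<le> q (s *\<^sub>R x + (s * t) *\<^sub>R y) - s * t * q y" using s t by (intro le) simp
      also have "s *\<^sub>R x + (s * t) *\<^sub>R y = s *\<^sub>R (x + t *\<^sub>R y)" by (simp add: algebra_simps)
      also have "q \<dots> = s * q (x + t *\<^sub>R y)" using s by (intro sublinear_scale[OF q]) simp
      finally show "r (s *\<^sub>R x) / s \<le> q (x + t *\<^sub>R y) - t * q y"
        using s by (simp add: field_simps)
    qed
    then show "r (s *\<^sub>R x) \<le> s * r x" using s by (simp add: field_simps)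
  qed
  moreover have "r x \<le> q x" for x using le[of 0 x] by simp
  moreover have "r x \<le> q (x + y) - q y" for x using le[of 1 x] by simp
  ultimately show ?thesis using that by blast
qed

text \<open>The infimum is finite because \<open>- p (- x)\<close> lies below every member at
  \<open>x\<close>. Subadditivity uses the chain: of two members the smaller one serves for both
  summands.\<close>

lemma sublinear_INF_chain:
  assumes C: "C \<noteq> {}" "\<And>q. q \<in> C \<Longrightarrow> sublinear q" "\<And>q x. q \<in> C \<Longrightarrow> q x \<le> p x"
    and chain: "\<And>q r. q \<in> C \<Longrightarrow> r \<in> C \<Longrightarrow> q \<le> r \<or> r \<le> q"
  obtains u where "sublinear u" "\<And>q x. q \<in> C \<Longrightarrow> u x \<le> q x"
proof -
  define u where "u x = (INF q\<in>C. q x)" for x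
  have "bdd_below ((\<lambda>q. q x) ` C)" for x
    using sublinear_lower[OF C(2)] C(3)[of _ "- x"]
    by (intro bdd_belowI2[of _ "- p (- x)"]) (meson neg_le_iff_le order_trans)
  then have le: "u x \<le> q x" if "q \<in> C" for q x
    unfolding u_def using that by (intro cINF_lower)
  have ge: "c \<le> u x" if "\<And>q. q \<in> C \<Longrightarrow> c \<le> q x" for c x
    unfolding u_def using that C(1) by (intro cINF_greatest)
  have "sublinear u"
  proof (rule sublinearI)
    fix x z
    have *: "u (x + z) \<le> q x + r z" if qr: "q \<in> C" "r \<in> C" for q r
    proof -
      obtain m where m: "m \<in> C" "m \<le> q" "m \<le> r" using chain[OF qr] qr by blast
      have "u (x + z) \<le> m x + m z"
        using le[OF m(1), of "x + z"] C(2)[OF m(1)] unfolding sublinear_def by (meson order_trans)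
      then show ?thesis using m(2,3) unfolding le_fun_def by (meson add_mono order_trans)
    qed
    have "u (x + z) - r z \<le> u x" if "r \<in> C" for r
      by (rule ge) (use *[OF _ that] in \<open>simp add: algebra_simps\<close>)
    then have "u (x + z) - u x \<le> u z" by (intro ge) (simp add: algebra_simps)
    then show "u (x + z) \<le> u x + u z" by simp
  next
    fix s :: real and x assume s: "s > 0"
    have "u (s *\<^sub>R x) / s \<le> u x"
    proof (rule ge)
      fix q assume q: "q \<in> C"
      have "u (s *\<^sub>R x) \<le> s * q x"
        using le[OF q, of "s *\<^sub>R x"] sublinear_scale[OF C(2)[OF q], of s x] s by simp
      then show "u (s *\<^sub>R x) / s \<le> q x" using s by (simp add: field_simps)
    qed
    then show "u (s *\<^sub>R x) \<le> s * u x" using s by (simp add: field_simps)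
  qed
  then show ?thesis using le that by blast
qed

text \<open>Hahn--Banach without partial functions: a minimal sublinear functional below \<open>p\<close> is already
  linear, because tilting it in a direction \<open>y\<close> would otherwise decrease it.\<close>

lemma sublinear_dominates_linear:
  fixes p :: "'a::real_vector \<Rightarrow> real"
  assumes p: "sublinear p"
  obtains l where "linear l" "\<And>x. l x \<le> p x"
proof -
  define A where "A = {q. sublinear q \<and> q \<le> p}"
  \<comment> \<open>Zorn's lemma yields maximal elements, so the order is reversed in order to
    obtain a minimal one.\<close>
  have "\<exists>m\<in>A. \<forall>a\<in>A. (\<lambda>q r. r \<le> q) m a \<longrightarrow> a = m"
  proof (rule predicate_Zorn)
    show "partial_order_on A (relation_of (\<lambda>q r. r \<le> q) A)"
      unfolding partial_order_on_def preorder_on_def relation_of_def refl_on_def trans_def antisym_def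
      by (blast intro: order_trans order_antisym)
    fix C assume "C \<in> Chains (relation_of (\<lambda>q r. r \<le> q) A)"
    then have C: "C \<subseteq> A" "\<And>q r. q \<in> C \<Longrightarrow> r \<in> C \<Longrightarrow> q \<le> r \<or> r \<le> q"
      unfolding Chains_def relation_of_def by auto
    show "\<exists>u\<in>A. \<forall>a\<in>C. u \<le> a"
    proof (cases "C = {}")
      case True then show ?thesis using p by (auto simp: A_def)
    next
      case False
      obtain u where "sublinear u" "\<And>q x. q \<in> C \<Longrightarrow> u x \<le> q x"
        using sublinear_INF_chain[of C p] False C by (auto simp: A_def le_fun_def)
      moreover obtain q where "q \<in> C" "q \<le> p" using False C(1) by (auto simp: A_def)
      ultimately have "u \<le> p" using \<open>\<And>q x. q \<in> C \<Longrightarrow> u x \<le> q x\<close> by (meson le_fun_def order_trans)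
      then show ?thesis using \<open>sublinear u\<close> \<open>\<And>q x. q \<in> C \<Longrightarrow> u x \<le> q x\<close>
        by (intro bexI[of _ u]) (auto simp: A_def le_fun_def)
    qed
  qed
  then obtain m where m: "sublinear m" "m \<le> p"
    and min: "\<And>r. sublinear r \<Longrightarrow> r \<le> m \<Longrightarrow> r = m"
    unfolding A_def by (smt (verit) mem_Collect_eq order_trans)
  have add: "m (x + y) = m x + m y" for x y
  proof -
    obtain r where r: "sublinear r" "\<And>x. r x \<le> m x" "\<And>x. r x \<le> m (x + y) - m y"
      using sublinear_tilt[OF m(1)] by blast
    then have "r = m" by (intro min) (auto simp: le_fun_def)
    then have "m x + m y \<le> m (x + y)" using r(3)[of x] by simp
    then show ?thesis using m(1) unfolding sublinear_def by (meson order_antisym)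
  qed
  have neg: "m (- x) = - m x" for x
    using add[of x "- x"] sublinear_zero[OF m(1)] by simp
  have "m (t *\<^sub>R x) = t *\<^sub>R m x" for t x
  proof (cases "t \<ge> 0")
    case True then show ?thesis using sublinear_scale[OF m(1)] by simp
  next
    case False
    then have "m ((- t) *\<^sub>R x) = - t * m x" by (intro sublinear_scale[OF m(1)]) simp
    then show ?thesis using neg[of "t *\<^sub>R x"] by simp
  qed
  then have "linear m" using add by (intro linearI)
  then show ?thesis using that m(2) by (auto simp: le_fun_def)
qed

lemma norming_functional:
  fixes y :: "'a::real_normed_vector"
  obtains l where "bounded_linear l" "\<And>x. \<bar>l x\<bar> \<le> norm x" "l y = norm y"
proof -
  have "sublinear (norm :: 'a \<Rightarrow> real)" by (rule sublinearI) (auto simp: norm_triangle_ineq)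
  then obtain r where r: "sublinear r" "\<And>x. r x \<le> norm x" "\<And>x. r x \<le> norm (x + y) - norm y"
    using sublinear_tilt by blast
  obtain l where l: "linear l" "\<And>x. l x \<le> r x" using sublinear_dominates_linear[OF r(1)] by blast
  have ln: "l x \<le> norm x" for x using l(2)[of x] r(2)[of x] by simp
  have ab: "\<bar>l x\<bar> \<le> norm x" for x
    using ln[of x] ln[of "- x"] linear_neg[OF l(1), of x] by simp
  \<comment> \<open>At \<open>- y\<close> the tilted bound reads \<open>norm 0 - norm y\<close>,
    which makes \<open>l\<close> attain the norm at \<open>y\<close>.\<close>
  have "l (- y) \<le> - norm y" using l(2)[of "- y"] r(3)[of "- y"] by simp
  then have "l y = norm y" using ln[of y] linear_neg[OF l(1), of y] by simp
  moreover have "bounded_linear l"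
    using l(1) ab by (intro linear_conv_bounded_linear[THEN iffD1] bounded_linear_intro[of l 1])
      (auto simp: linear_add linear_scale)
  ultimately show ?thesis using ab that by blast
qed

subsection \<open>Singular vectors of a real matrix\<close>

text \<open>The dimension varies with \<open>n\<close>, so vectors are functions on the naturals of which only the
  coordinates below \<open>N\<close> matter.\<close>

definition ip :: "nat \<Rightarrow> (nat \<Rightarrow> real) \<Rightarrow> (nat \<Rightarrow> real) \<Rightarrow> real" where
  "ip N x y = (\<Sum>i<N. x i * y i)"

definition mv :: "nat \<Rightarrow> (nat \<Rightarrow> nat \<Rightarrow> real) \<Rightarrow> (nat \<Rightarrow> real) \<Rightarrow> nat \<Rightarrow> real" where
  "mv N M x i = (\<Sum>j<N. M i j * x j)"

lemma ip_commute: "ip N x y = ip N y x"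
  by (simp add: ip_def mult.commute)

lemma ip_add_left: "ip N (\<lambda>i. x i + y i) z = ip N x z + ip N y z"
  by (simp add: ip_def algebra_simps sum.distrib)

lemma ip_scale_left: "ip N (\<lambda>i. c * x i) z = c * ip N x z"
  by (simp add: ip_def algebra_simps sum_distrib_left)

lemma ip_sum_left: "ip N (\<lambda>i. \<Sum>j\<in>J. f j i) z = (\<Sum>j\<in>J. ip N (f j) z)"
  unfolding ip_def by (simp add: sum_distrib_right) (rule sum.swap)

lemma ip_self_nonneg: "0 \<le> ip N x x"
  by (simp add: ip_def sum_nonneg)

lemma mv_add: "mv N M (\<lambda>i. x i + y i) = (\<lambda>i. mv N M x i + mv N M y i)"
  by (simp add: mv_def fun_eq_iff algebra_simps sum.distrib)

lemma mv_scale: "mv N M (\<lambda>i. c * x i) = (\<lambda>i. c * mv N M x i)"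
  by (simp add: mv_def fun_eq_iff algebra_simps sum_distrib_left)

lemma mv_sum: "mv N M (\<lambda>i. \<Sum>j\<in>J. f j i) = (\<lambda>i. \<Sum>j\<in>J. mv N M (f j) i)"
  unfolding mv_def by (rule ext, simp add: sum_distrib_left) (rule sum.swap)

text \<open>Pythagoras for an orthogonal family with squared lengths \<open>s\<close>, applied both
  to the orthonormal singular vectors and to their orthogonal images.\<close>

lemma ip_combination:
  fixes m :: nat
  assumes "\<And>i j. i < m \<Longrightarrow> j < m \<Longrightarrow> ip N (v i) (v j) = (if i = j then s i else 0)"
  shows "ip N (\<lambda>i. \<Sum>j<m. z j * v j i) (\<lambda>i. \<Sum>j<m. z j * v j i) = (\<Sum>j<m. (z j)\<^sup>2 * s j)"
proof -
  have "ip N (\<lambda>i. \<Sum>j<m. z j * v j i) (\<lambda>i. \<Sum>j<m. z j * v j i)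
      = (\<Sum>j<m. \<Sum>k<m. z j * z k * ip N (v j) (v k))"
    by (simp add: ip_sum_left ip_scale_left ip_commute[of N _ "\<lambda>i. \<Sum>j<m. z j * v j i"])
       (simp add: ip_commute sum_distrib_left mult.assoc)
  also have "\<dots> = (\<Sum>j<m. \<Sum>k<m. if j = k then (z j)\<^sup>2 * s j else 0)"
    using assms by (intro sum.cong refl) (auto simp: power2_eq_square)
  also have "\<dots> = (\<Sum>j<m. (z j)\<^sup>2 * s j)"
    by (intro sum.cong refl) simp
  finally show ?thesis .
qed

text \<open>The coordinates from \<open>N\<close> on are pinned to 0, so the set is a closed part of
  a product of compact sets and Tychonoff's theorem applies.\<close>

lemma compact_sphere_orthogonal:
  "compact {x::nat \<Rightarrow> real. (\<forall>i\<ge>N. x i = 0) \<and> ip N x x = 1 \<and> (\<forall>j<m. ip N (v j) x = 0)}"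
    (is "compact ?S")
proof -
  let ?B = "PiE UNIV (\<lambda>i::nat. if i < N then {-1..1::real} else {0})"
  have "compactin (product_topology (\<lambda>i. euclidean) UNIV) ?B"
    unfolding compactin_PiE by auto
  then have "compact ?B" by (simp add: euclidean_product_topology)
  have ci: "continuous_on UNIV (\<lambda>x::nat \<Rightarrow> real. x i)" for i
    by (rule continuous_on_product_coordinates)
  have "closed ({x::nat \<Rightarrow> real. ip N x x = 1} \<inter> (\<Inter>j\<in>{..<m}. {x. ip N (v j) x = 0}))"
    unfolding ip_def
    by (intro closed_Int closed_INT ballI closed_Collect_eq continuous_intros ci)
  with \<open>compact ?B\<close> have "compact (?B \<inter> ({x. ip N x x = 1} \<inter> (\<Inter>j\<in>{..<m}. {x. ip N (v j) x = 0})))"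
    by (rule compact_Int_closed)
  moreover have "x \<in> ?B" if "\<forall>i\<ge>N. x i = 0" "ip N x x = 1" for x
  proof -
    have "\<bar>x i\<bar> \<le> 1" if "i < N" for i
    proof -
      have "(x i)\<^sup>2 \<le> ip N x x" unfolding ip_def power2_eq_square using that
        by (intro member_le_sum[of i "{..<N}" "\<lambda>i. x i * x i"]) auto
      then show ?thesis using \<open>ip N x x = 1\<close> by (simp add: abs_square_le_1)
    qed
    then show ?thesis using that by (auto simp: PiE_iff abs_le_iff minus_le_iff)
  qed
  then have "?B \<inter> ({x. ip N x x = 1} \<inter> (\<Inter>j\<in>{..<m}. {x. ip N (v j) x = 0})) = ?S"
    by (auto simp: PiE_iff) (metis empty_iff insert_iff not_less)
  ultimately show ?thesis by simp
qed

text \<open>Summed over \<open>l < N\<close>, the squared projections of the unit vectors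
  \<open>e_l\<close> to the span of \<open>m\<close> orthonormal vectors total \<open>m < N\<close>.
  Hence some \<open>e_l\<close> projects to length below 1, and its component orthogonal to the span
  can be normalised.\<close>

lemma orthonormal_extend:
  assumes on: "\<And>i j. i < m \<Longrightarrow> j < m \<Longrightarrow> ip N (v i) (v j) = (if i = j then 1 else 0)" and "m < N"
  obtains x where "\<And>i. i \<ge> N \<Longrightarrow> x i = 0" "ip N x x = 1" "\<And>j. j < m \<Longrightarrow> ip N (v j) x = 0"
proof -
  have "(\<Sum>l<N. \<Sum>i<m. (v i l)\<^sup>2) = (\<Sum>i<m. ip N (v i) (v i))"
    unfolding ip_def power2_eq_square by (rule sum.swap)
  also have "\<dots> = real m" using on by simp
  also have "\<dots> < (\<Sum>l<N. 1)" using \<open>m < N\<close> by simp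
  finally obtain l where l: "l < N" "(\<Sum>i<m. (v i l)\<^sup>2) < 1"
    by (metis (no_types, lifting) lessThan_iff not_less sum_mono)
  define e where "e = (\<lambda>i. if i = l then 1 else 0::real)"
  have ipe: "ip N e y = y l" for y 
    using l(1) by (simp add: ip_def e_def if_distribR[of _ _ "(*)"] if_distrib[of "\<lambda>a. a * _"] cong: if_cong)
  define u where "u = (\<lambda>i. e i + (\<Sum>j<m. (- v j l) * v j i))"
  have uj: "ip N u (v j) = 0" if "j < m" for j
  proof -
    have "ip N u (v j) = v j l + (\<Sum>k<m. (- v k l) * ip N (v k) (v j))"
      unfolding u_def ip_add_left ip_sum_left ip_scale_left ipe by simp
    also have "(\<Sum>k<m. (- v k l) * ip N (v k) (v j)) = (\<Sum>k<m. if k = j then - v k l else 0)"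
      using on that by (intro sum.cong) auto
    finally show ?thesis using that by simp
  qed
  have "ip N u u = u l + (\<Sum>k<m. (- v k l) * ip N (v k) u)"
    by (subst (1) u_def) (simp only: ip_add_left ip_sum_left ip_scale_left ipe)
  also have "(\<Sum>k<m. (- v k l) * ip N (v k) u) = 0" using uj by (simp add: ip_commute)
  finally have uu: "ip N u u > 0" using l(2)
    by (simp add: u_def e_def power2_eq_square sum_negf)
  define s where "s = 1 / sqrt (ip N u u)"
  define x where "x = (\<lambda>i. if i < N then s * u i else 0)"
  have eq: "ip N x y = s * ip N u y" for y
    unfolding ip_def x_def by (simp add: sum_distrib_left mult.assoc)
  show ?thesis
  proof
    show "x i = 0" if "i \<ge> N" for i using that by (simp add: x_def)
    have "ip N x x = s * (s * ip N u u)" by (metis eq ip_commute)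
    then show "ip N x x = 1" using uu by (simp add: s_def field_simps)
    show "ip N (v j) x = 0" if "j < m" for j 
      using uj[OF that] eq[of "v j"] by (simp add: ip_commute[of N "v j"])
  qed
qed

text \<open>Compactness supplies a maximiser of the length of \<open>mv N M x\<close> on the unit
  sphere orthogonal to the vectors chosen so far; homogeneity extends the bound to all
  \<open>x\<close>.\<close>

lemma greedy_singular_vectors:
  assumes "m \<le> N"
  shows "\<exists>v. (\<forall>i<m. \<forall>j<m. ip N (v i) (v j) = (if i = j then 1 else 0)) \<and>
    (\<forall>i<m. \<forall>x. (\<forall>j<i. ip N (v j) x = 0) \<longrightarrow>
        ip N (mv N M x) (mv N M x) \<le> ip N (mv N M (v i)) (mv N M (v i)) * ip N x x)"
  using assms
proof (induction m)
  case 0 then show ?case by simp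
next
  case (Suc m)
  then obtain v where on: "\<And>i j. i < m \<Longrightarrow> j < m \<Longrightarrow> ip N (v i) (v j) = (if i = j then 1 else 0)"
    and mx: "\<And>i x. i < m \<Longrightarrow> (\<forall>j<i. ip N (v j) x = 0) \<Longrightarrow>
        ip N (mv N M x) (mv N M x) \<le> ip N (mv N M (v i)) (mv N M (v i)) * ip N x x"
    by (metis Suc_leD)
  let ?S = "{x::nat \<Rightarrow> real. (\<forall>i\<ge>N. x i = 0) \<and> ip N x x = 1 \<and> (\<forall>j<m. ip N (v j) x = 0)}"
  have "m < N" using Suc by simp
  obtain x where "\<And>i. i \<ge> N \<Longrightarrow> x i = 0" "ip N x x = 1" "\<And>j. j < m \<Longrightarrow> ip N (v j) x = 0"
    using orthonormal_extend[OF on \<open>m < N\<close>] by metis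
  then have "x \<in> ?S" by simp
  then have "?S \<noteq> {}" by blast
  have ci: "continuous_on A (\<lambda>x::nat \<Rightarrow> real. x i)" for i A
    by (rule continuous_on_subset[OF continuous_on_product_coordinates]) simp
  have "continuous_on ?S (\<lambda>x. ip N (mv N M x) (mv N M x))"
    unfolding ip_def mv_def by (intro continuous_intros ci)
  from continuous_attains_sup[OF compact_sphere_orthogonal \<open>?S \<noteq> {}\<close> this] obtain w where w: "w \<in> ?S"
    and wm: "\<And>x. x \<in> ?S \<Longrightarrow> ip N (mv N M x) (mv N M x) \<le> ip N (mv N M w) (mv N M w)"
    by blast
  have wmax: "ip N (mv N M x) (mv N M x) \<le> ip N (mv N M w) (mv N M w) * ip N x x"
    if x: "\<forall>j<m. ip N (v j) x = 0" for x
  proof (cases "ip N x x = 0")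
    case True
    then have "\<forall>i<N. x i = 0" unfolding ip_def by (subst (asm) sum_nonneg_eq_0_iff) auto
    then have "mv N M x = (\<lambda>i. 0)" by (simp add: mv_def fun_eq_iff)
    then show ?thesis using True by (simp add: ip_def)
  next
    case False
    then have p: "ip N x x > 0" using ip_self_nonneg[of N x] by simp
    define s where "s = 1 / sqrt (ip N x x)"
    \<comment> \<open>Normalising and cutting off the coordinates from \<open>N\<close> on moves
      \<open>x\<close> into the compact set; neither \<open>ip N\<close> nor \<open>mv N\<close>
      notices the cut.\<close>
    define y where "y = (\<lambda>i. if i < N then s * x i else 0)"
    have eq: "ip N y z = s * ip N x z" for z
      unfolding ip_def y_def by (simp add: sum_distrib_left mult.assoc)
    have "ip N y y = s * (s * ip N x x)" by (metis eq ip_commute)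
    then have "ip N y y = 1" using p by (simp add: s_def field_simps)
    moreover have "ip N (v j) y = 0" if "j < m" for j
      using x eq[of "v j"] that ip_commute[of N "v j" y] ip_commute[of N "v j" x] by simp
    ultimately have "y \<in> ?S" by (auto simp: y_def)
    then have "ip N (mv N M y) (mv N M y) \<le> ip N (mv N M w) (mv N M w)" by (rule wm)
    moreover have "mv N M y = (\<lambda>i. s * mv N M x i)"
      by (simp add: mv_def y_def fun_eq_iff sum_distrib_left algebra_simps)
    then have "ip N (mv N M y) (mv N M y) = s * (s * ip N (mv N M x) (mv N M x))"
      by (metis ip_commute ip_scale_left)
    ultimately show ?thesis using p by (simp add: s_def field_simps)
  qed
  show ?case
  proof (intro exI[of _ "v(m := w)"] conjI allI impI)
    fix i j assume "i < Suc m" "j < Suc m"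
    then show "ip N ((v(m := w)) i) ((v(m := w)) j) = (if i = j then 1 else 0)"
      using on w by (auto simp: less_Suc_eq ip_commute)
  next
    fix i x assume i: "i < Suc m" and x: "\<forall>j<i. ip N ((v(m := w)) j) x = 0"
    show "ip N (mv N M x) (mv N M x)
        \<le> ip N (mv N M ((v(m := w)) i)) (mv N M ((v(m := w)) i)) * ip N x x"
      using i x mx[of i x] wmax[of x] by (cases "i = m") auto
  qed
qed

lemma linear_le_quadratic_imp_zero:
  fixes a b :: real
  assumes "\<And>t. t * a \<le> t\<^sup>2 * b"
  shows "a = 0"
proof (rule ccontr)
  assume a: "a \<noteq> 0"
  \<comment> \<open>With this choice \<open>t^2 * (|b| + 1)\<close> is half of \<open>t * a\<close>,
    so the assumption would force \<open>t * a \<le> 0\<close>.\<close>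
  define t where "t = a / (2 * (\<bar>b\<bar> + 1))"
  have eq: "a = t * (2 * (\<bar>b\<bar> + 1))" unfolding t_def by (simp add: nonzero_divide_eq_eq)
  have "t * a \<le> t\<^sup>2 * \<bar>b\<bar>" using assms[of t] by (smt (verit) mult_left_mono zero_le_power2)
  also have "\<dots> \<le> t\<^sup>2 * (\<bar>b\<bar> + 1)" by (intro mult_left_mono) auto
  also have "\<dots> = t * a / 2" by (subst eq) (simp add: power2_eq_square algebra_simps)
  finally have "t * a \<le> t * a / 2" .
  then have "t * a \<le> 0" by linarith
  moreover have "t \<noteq> 0" using a eq by auto
  then have "0 < t * t" by (metis not_real_square_gt_zero)
  then have "0 < (t * t) * (2 * (\<bar>b\<bar> + 1))" by (rule mult_pos_pos) simp
  then have "t * a > 0" by (subst eq) (simp add: mult.assoc)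
  ultimately show False by simp
qed

text \<open>The squared lengths of the images are the squared singular values in decreasing order.
  Their orthogonality is the first-order condition for a maximum: moving \<open>v i\<close> in the
  direction of a later \<open>v j\<close> cannot increase the Rayleigh quotient.\<close>

lemma singular_vectors:
  obtains v where "\<And>i j. i < N \<Longrightarrow> j < N \<Longrightarrow> ip N (v i) (v j) = (if i = j then 1 else 0)"
    "\<And>i j. i < N \<Longrightarrow> j < N \<Longrightarrow> i \<noteq> j \<Longrightarrow> ip N (mv N M (v i)) (mv N M (v j)) = 0"
    "\<And>i j. i \<le> j \<Longrightarrow> j < N \<Longrightarrow>
       ip N (mv N M (v j)) (mv N M (v j)) \<le> ip N (mv N M (v i)) (mv N M (v i))"
proof -
  obtain v where on: "\<And>i j. i < N \<Longrightarrow> j < N \<Longrightarrow> ip N (v i) (v j) = (if i = j then 1 else 0)"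
    and mx: "\<And>i x. i < N \<Longrightarrow> (\<forall>j<i. ip N (v j) x = 0) \<Longrightarrow>
        ip N (mv N M x) (mv N M x) \<le> ip N (mv N M (v i)) (mv N M (v i)) * ip N x x"
    using greedy_singular_vectors[of N N M] by blast
  let ?T = "mv N M"
  have orth: "ip N (?T (v i)) (?T (v j)) = 0" if ij: "i < j" "j < N" for i j
  proof -
    let ?G = "ip N (?T (v i)) (?T (v j))"
    have "t * (2 * ?G) \<le> t\<^sup>2 * (ip N (?T (v i)) (?T (v i)) - ip N (?T (v j)) (?T (v j)))" for t
    proof -
      let ?x = "\<lambda>k. v i k + t * v j k"
      have "ip N (v k) ?x = 0" if "k < i" for k
        using on[of k i] on[of k j] that ij
        by (simp add: ip_commute[of N "v k"] ip_add_left ip_scale_left)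
      then have "ip N (?T ?x) (?T ?x) \<le> ip N (?T (v i)) (?T (v i)) * ip N ?x ?x"
        using ij by (intro mx) auto
      moreover have bil: "ip N (\<lambda>k. a k + t * b k) (\<lambda>k. a k + t * b k)
          = ip N a a + 2 * t * ip N a b + t\<^sup>2 * ip N b b" for a b
        unfolding ip_def by (simp add: algebra_simps power2_eq_square sum.distrib sum_distrib_left)
      ultimately show ?thesis using on[of i i] on[of j j] on[of i j] ij
        by (simp add: mv_add mv_scale bil algebra_simps)
    qed
    then have "2 * ?G = 0" by (rule linear_le_quadratic_imp_zero)
    then show ?thesis by simp
  qed
  show ?thesis
  proof
    show "ip N (?T (v i)) (?T (v j)) = 0" if "i < N" "j < N" "i \<noteq> j" for i j
      using orth[of i j] orth[of j i] that by (cases "i < j") (auto simp: ip_commute)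
    show "ip N (?T (v j)) (?T (v j)) \<le> ip N (?T (v i)) (?T (v i))" if "i \<le> j" "j < N" for i j
      using mx[of i "v j"] on[of j j] on[of _ j] that by simp
  qed (rule on)
qed

text \<open>Both sides are the squared determinant of \<open>M\<close>: the matrix \<open>V\<close>
  of the singular vectors has determinant 1 or -1, the Gram matrix of \<open>A * V\<close> is
  diagonal, and \<open>A\<close> is triangular.\<close>

lemma prod_singular_values:
  assumes on: "\<And>i j. i < N \<Longrightarrow> j < N \<Longrightarrow> ip N (v i) (v j) = (if i = j then 1 else 0)"
    and orth: "\<And>i j. i < N \<Longrightarrow> j < N \<Longrightarrow> i \<noteq> j \<Longrightarrow> ip N (mv N M (v i)) (mv N M (v j)) = 0"
    and tri: "\<And>i j. i < j \<Longrightarrow> j < N \<Longrightarrow> M i j = 0"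
  shows "(\<Prod>j<N. ip N (mv N M (v j)) (mv N M (v j))) = (\<Prod>j<N. M j j)\<^sup>2"
proof -
  define V where "V = mat N N (\<lambda>(i, j). v j i)"
  define A where "A = mat N N (\<lambda>(i, j). M i j)"
  have [simp]: "V \<in> carrier_mat N N" "A \<in> carrier_mat N N" by (auto simp: V_def A_def)
  have "transpose_mat V * V = 1\<^sub>m N"
    by (rule eq_matI) (use on in \<open>auto simp: V_def scalar_prod_def ip_def lessThan_atLeast0\<close>)
  then have "det (transpose_mat V * V) = 1" by simp
  then have V1: "det V * det V = 1" by (simp add: det_mult[of _ N] det_transpose[of _ N])
  let ?D = "mat N N (\<lambda>(i, j). if i = j then ip N (mv N M (v i)) (mv N M (v i)) else 0)"
  have AV: "A * V = mat N N (\<lambda>(i, j). mv N M (v j) i)"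
    by (rule eq_matI) (auto simp: V_def A_def mv_def scalar_prod_def lessThan_atLeast0)
  have "transpose_mat (A * V) * (A * V) = ?D"
    unfolding AV by (rule eq_matI) (use orth in \<open>auto simp: scalar_prod_def ip_def lessThan_atLeast0\<close>)
  then have "det (A * V) * det (A * V) = det ?D"
    by (metis AV det_mult det_transpose mat_carrier transpose_carrier_mat)
  also have "det ?D = prod_list (diag_mat ?D)" by (rule det_lower_triangular[of N]) auto
  also have "\<dots> = (\<Prod>j<N. ip N (mv N M (v j)) (mv N M (v j)))"
    by (simp add: prod_list_diag_prod lessThan_atLeast0)
  finally have "(det A)\<^sup>2 * (det V * det V) = (\<Prod>j<N. ip N (mv N M (v j)) (mv N M (v j)))"
    by (simp add: det_mult[of _ N] power2_eq_square algebra_simps)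
  moreover have "det A = prod_list (diag_mat A)"
    by (rule det_lower_triangular[of N]) (auto simp: A_def tri)
  then have "det A = (\<Prod>j<N. M j j)"
    by (simp add: prod_list_diag_prod lessThan_atLeast0 A_def)
  ultimately show ?thesis using V1 by simp
qed

subsection \<open>Iterated Lebesgue integrals and rotations\<close>

abbreviation RN :: "(nat \<Rightarrow> real) measure" where
  "RN \<equiv> PiM UNIV (\<lambda>_. borel)"

text \<open>\<open>iint m g z\<close> integrates \<open>g\<close> over the first \<open>m\<close> coordinates; the others are kept as in \<open>z\<close>.\<close>

primrec iint :: "nat \<Rightarrow> ((nat \<Rightarrow> real) \<Rightarrow> ennreal) \<Rightarrow> (nat \<Rightarrow> real) \<Rightarrow> ennreal" where
  "iint 0 g z = g z"
| "iint (Suc m) g z = (\<integral>\<^sup>+t. iint m g (z(m := t)) \<partial>lborel)"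

lemma in_space_RN [simp, measurable]: "z \<in> space RN"
  by (simp add: space_PiM)

lemma measurable_RN_upd [measurable (raw)]:
  assumes "f \<in> measurable N RN" "h \<in> borel_measurable N"
  shows "(\<lambda>x. (f x)(i := h x)) \<in> measurable N RN"
  using assms by (intro measurable_fun_upd[of _ UNIV]) auto

text \<open>The parameter \<open>w\<close>, later the random seed, is carried along so that
  coordinate integrals can be exchanged with the expectation.\<close>

lemma iint_measurable_joint:
  assumes "(\<lambda>(x, w). h x w) \<in> borel_measurable (RN \<Otimes>\<^sub>M M)"
  shows "(\<lambda>(z, w). iint m (\<lambda>x. h x w) z) \<in> borel_measurable (RN \<Otimes>\<^sub>M M)"
proof (induction m)
  case 0 then show ?case using assms by simp
next
  case (Suc m)
  have "(\<lambda>p. ((fst (fst p))(m := snd p), snd (fst p))) \<in> measurable ((RN \<Otimes>\<^sub>M M) \<Otimes>\<^sub>M lborel) (RN \<Otimes>\<^sub>M M)"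
    by measurable
  from measurable_compose[OF this Suc]
  have "(\<lambda>p. iint m (\<lambda>x. h x (snd (fst p))) ((fst (fst p))(m := snd p))) \<in> borel_measurable ((RN \<Otimes>\<^sub>M M) \<Otimes>\<^sub>M lborel)"
    by (simp add: case_prod_beta)
  then show ?case
    using lborel.borel_measurable_nn_integral[of "\<lambda>zw t. iint m (\<lambda>x. h x (snd zw)) ((fst zw)(m := t))" "RN \<Otimes>\<^sub>M M"]
    by (simp add: case_prod_beta)
qed

lemma iint_measurable [measurable]:
  assumes [measurable]: "g \<in> borel_measurable RN"
  shows "iint m g \<in> borel_measurable RN"
proof (induction m)
  case 0 then show ?case by (simp add: assms eta_contract_eq cong: measurable_cong)
next
  case (Suc m)
  note [measurable] = Suc
  have "(\<lambda>z. \<integral>\<^sup>+t. iint m g (z(m := t)) \<partial>lborel) \<in> borel_measurable RN" by measurable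
  then show ?case by (simp cong: measurable_cong)
qed

lemma iint_mono:
  assumes "\<And>x. (\<And>i. i \<ge> m \<Longrightarrow> x i = z i) \<Longrightarrow> f x \<le> g x"
  shows "iint m f z \<le> iint m g z"
  using assms
proof (induction m arbitrary: z)
  case (Suc m)
  have "iint m f (z(m := t)) \<le> iint m g (z(m := t))" for t
  proof (rule Suc.IH)
    fix x assume "\<And>i. i \<ge> m \<Longrightarrow> x i = (z(m := t)) i"
    then show "f x \<le> g x" by (intro Suc.prems) (metis Suc_le_eq Suc_leD fun_upd_other less_irrefl)
  qed
  then show ?case by (simp add: nn_integral_mono)
qed auto

lemma iint_add:
  assumes [measurable]: "f \<in> borel_measurable RN" "g \<in> borel_measurable RN"
  shows "iint m (\<lambda>x. f x + g x) z = iint m f z + iint m g z"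
  by (induction m arbitrary: z) (auto simp: nn_integral_add)

lemma iint_cmult:
  assumes [measurable]: "f \<in> borel_measurable RN"
  shows "iint m (\<lambda>x. c * f x) z = c * iint m f z"
  by (induction m arbitrary: z) (auto simp: nn_integral_cmult)

lemma iint_sum:
  assumes "\<And>i. i \<in> I \<Longrightarrow> f i \<in> borel_measurable RN"
  shows "iint m (\<lambda>x. \<Sum>i\<in>I. f i x) z = (\<Sum>i\<in>I. iint m (f i) z)"
  using assms
proof (induction I rule: infinite_finite_induct)
  case (insert a I)
  then show ?case by (simp add: iint_add)
next
  have *: "iint m (\<lambda>x. 0) z = 0" for z by (induction m arbitrary: z) auto
  case (infinite A) then show ?case using * by simp
next
  have *: "iint m (\<lambda>x. 0) z = 0" for z by (induction m arbitrary: z) auto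
  case empty then show ?case using * by simp
qed

lemma iint_nn_integral_swap:
  assumes "sigma_finite_measure M" and h: "(\<lambda>(x, w). h x w) \<in> borel_measurable (RN \<Otimes>\<^sub>M M)"
  shows "iint m (\<lambda>x. \<integral>\<^sup>+w. h x w \<partial>M) z = (\<integral>\<^sup>+w. iint m (\<lambda>x. h x w) z \<partial>M)"
proof (induction m arbitrary: z)
  case (Suc m)
  interpret M: sigma_finite_measure M by fact
  interpret pair_sigma_finite lborel M ..
  have "(\<lambda>p. (z(m := fst p), snd p)) \<in> measurable (lborel \<Otimes>\<^sub>M M) (RN \<Otimes>\<^sub>M M)" by measurable
  from measurable_compose[OF this iint_measurable_joint[OF h, of m]]
  have "(\<lambda>(t, w). iint m (\<lambda>x. h x w) (z(m := t))) \<in> borel_measurable (lborel \<Otimes>\<^sub>M M)"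
    by (simp add: case_prod_beta)
  then show ?case using Fubini[of "\<lambda>(t, w). iint m (\<lambda>x. h x w) (z(m := t))"] 
    unfolding iint.simps Suc.IH by simp
qed simp

text \<open>A Givens rotation with \<open>c\<close> and \<open>s\<close> as cosine and sine.
  Neighbouring coordinates suffice, since a vector can be emptied one coordinate after the other
  from the left.\<close>

definition rot :: "nat \<Rightarrow> real \<Rightarrow> real \<Rightarrow> (nat \<Rightarrow> real) \<Rightarrow> nat \<Rightarrow> real" where
  "rot i c s x = x(i := c * x i - s * x (Suc i), Suc i := s * x i + c * x (Suc i))"

lemma rot_measurable [measurable]: "rot i c s \<in> measurable RN RN"
  unfolding rot_def by measurable

lemma rot_other: "j \<noteq> i \<Longrightarrow> j \<noteq> Suc i \<Longrightarrow> rot i c s x j = x j"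
  by (simp add: rot_def)

lemma rot_diff: "rot i c s (\<lambda>j. x j - y j) = (\<lambda>j. rot i c s x j - rot i c s y j)"
  by (auto simp: rot_def fun_eq_iff algebra_simps)

lemma rot_inverse: "c\<^sup>2 + s\<^sup>2 = 1 \<Longrightarrow> rot i c (- s) (rot i c s x) = x"
proof -
  assume "c\<^sup>2 + s\<^sup>2 = 1"
  then have *: "c * c + s * s = 1" by (simp add: power2_eq_square)
  have "c * (c * a - s * b) + s * (s * a + c * b) = a" "c * (s * a + c * b) - s * (c * a - s * b) = b"
    for a b using arg_cong[OF *, of "\<lambda>q. a * q"] arg_cong[OF *, of "\<lambda>q. b * q"]
    by (simp_all add: algebra_simps)
  then show ?thesis by (auto simp: rot_def fun_eq_iff)
qed

lemma ip_rot_adjoint: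
  assumes "Suc i < M"
  shows "ip M a (rot i c s x) = ip M (rot i c (- s) a) x"
proof -
  have split: "(\<Sum>j<M. f j) = f i + f (Suc i) + (\<Sum>j\<in>{..<M} - {i, Suc i}. f j)" for f :: "nat \<Rightarrow> real"
    using assms sum.subset_diff[of "{i, Suc i}" "{..<M}" f] by simp
  have "(\<Sum>j\<in>{..<M} - {i, Suc i}. a j * rot i c s x j) = (\<Sum>j\<in>{..<M} - {i, Suc i}. rot i c (- s) a j * x j)"
    by (intro sum.cong) (auto simp: rot_other)
  then show ?thesis unfolding ip_def split by (simp add: rot_def algebra_simps)
qed

lemma ip_rot:
  assumes "Suc i < M" "c\<^sup>2 + s\<^sup>2 = 1"
  shows "ip M (rot i c s x) (rot i c s y) = ip M x y"
  using assms by (simp add: ip_rot_adjoint rot_inverse)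

text \<open>The rotation is split into two one-dimensional affine substitutions whose Jacobians
  \<open>|c|\<close> and \<open>1 / |c|\<close> cancel. For \<open>c = 0\<close> it only exchanges
  the variables up to sign.\<close>

lemma nn_integral_rotation:
  fixes f :: "real \<Rightarrow> real \<Rightarrow> ennreal"
  assumes [measurable]: "(\<lambda>(a, b). f a b) \<in> borel_measurable (borel \<Otimes>\<^sub>M borel)" and cs: "c\<^sup>2 + s\<^sup>2 = 1"
  shows "(\<integral>\<^sup>+t. \<integral>\<^sup>+u. f (c * u - s * t) (s * u + c * t) \<partial>lborel \<partial>lborel)
      = (\<integral>\<^sup>+t. \<integral>\<^sup>+u. f u t \<partial>lborel \<partial>lborel)" (is "?L = ?R")
proof -
  have fub: "(\<integral>\<^sup>+t. \<integral>\<^sup>+u. h u t \<partial>lborel \<partial>lborel) = (\<integral>\<^sup>+u. \<integral>\<^sup>+t. h u t \<partial>lborel \<partial>lborel)"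
    if "(\<lambda>(a, b). h a b) \<in> borel_measurable (borel \<Otimes>\<^sub>M borel)" for h :: "real \<Rightarrow> real \<Rightarrow> ennreal"
    using lborel_pair.Fubini[of "\<lambda>(u, t). h u t"] that by simp
  show ?thesis
  proof (cases "c = 0")
    case True
    then have s: "\<bar>s\<bar> = 1" "s \<noteq> 0" using cs by (auto simp: power2_eq_1_iff)
    have "?L = (\<integral>\<^sup>+t. \<integral>\<^sup>+u. f (0 + (- s) * t) (0 + s * u) \<partial>lborel \<partial>lborel)" using True by simp
    also have "\<dots> = (\<integral>\<^sup>+t. \<integral>\<^sup>+b. f (0 + (- s) * t) b \<partial>lborel \<partial>lborel)"
    proof (rule nn_integral_cong)
      fix t show "(\<integral>\<^sup>+u. f (0 + (- s) * t) (0 + s * u) \<partial>lborel) = (\<integral>\<^sup>+b. f (0 + (- s) * t) b \<partial>lborel)"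
        using nn_integral_real_affine[of "f (0 + (- s) * t)" s 0] s by simp
    qed
    also have "\<dots> = (\<integral>\<^sup>+a. \<integral>\<^sup>+b. f a b \<partial>lborel \<partial>lborel)"
      using nn_integral_real_affine[of "\<lambda>a. \<integral>\<^sup>+b. f a b \<partial>lborel" "- s" 0] s by simp
    finally show ?thesis using fub[of f] by simp
  next
    case False
    have "ennreal \<bar>c\<bar> * ?L = (\<integral>\<^sup>+t. ennreal \<bar>c\<bar> * \<integral>\<^sup>+u. f (c * u - s * t) (s * u + c * t) \<partial>lborel \<partial>lborel)"
      by (rule nn_integral_cmult[symmetric]) measurable
    also have "\<dots> = (\<integral>\<^sup>+t. \<integral>\<^sup>+a. f a (s / c * a + 1 / c * t) \<partial>lborel \<partial>lborel)"
    proof (rule nn_integral_cong)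
      fix t
      \<comment> \<open>With \<open>a = c * u - s * t\<close> as new variable the second coordinate
        becomes \<open>s / c * a + 1 / c * t\<close>, which is affine in \<open>t\<close> for fixed
        \<open>a\<close>.\<close>
      have "s / c * (- s * t + c * u) + 1 / c * t = s * u + c * t" for u
      proof -
        have "s / c * (- s * t + c * u) + 1 / c * t = s * u + (1 - s\<^sup>2) * t / c"
          using False by (simp add: field_simps power2_eq_square)
        also have "1 - s\<^sup>2 = c * c" using cs by (simp add: power2_eq_square)
        finally show ?thesis using False by simp
      qed
      then show "ennreal \<bar>c\<bar> * (\<integral>\<^sup>+u. f (c * u - s * t) (s * u + c * t) \<partial>lborel)
          = (\<integral>\<^sup>+a. f a (s / c * a + 1 / c * t) \<partial>lborel)"
        using nn_integral_real_affine[of "\<lambda>a. f a (s / c * a + 1 / c * t)" c "- s * t"] False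
        by (simp add: algebra_simps)
    qed
    also have "\<dots> = (\<integral>\<^sup>+a. \<integral>\<^sup>+t. f a (s / c * a + 1 / c * t) \<partial>lborel \<partial>lborel)"
      by (rule fub) measurable
    also have "\<dots> = (\<integral>\<^sup>+a. ennreal \<bar>c\<bar> * \<integral>\<^sup>+b. f a b \<partial>lborel \<partial>lborel)"
    proof (rule nn_integral_cong)
      fix a
      have "ennreal \<bar>c\<bar> * (\<integral>\<^sup>+b. f a b \<partial>lborel)
          = ennreal \<bar>c\<bar> * (ennreal \<bar>1 / c\<bar> * (\<integral>\<^sup>+t. f a (s / c * a + 1 / c * t) \<partial>lborel))"
        using nn_integral_real_affine[of "f a" "1 / c" "s / c * a"] False by simp
      also have "\<dots> = (ennreal \<bar>c\<bar> * ennreal \<bar>1 / c\<bar>) * (\<integral>\<^sup>+t. f a (s / c * a + 1 / c * t) \<partial>lborel)"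
        by (simp add: mult.assoc)
      also have "ennreal \<bar>c\<bar> * ennreal \<bar>1 / c\<bar> = 1"
        using False by (simp add: ennreal_mult'[symmetric] abs_divide)
      finally show "(\<integral>\<^sup>+t. f a (s / c * a + 1 / c * t) \<partial>lborel) = ennreal \<bar>c\<bar> * (\<integral>\<^sup>+b. f a b \<partial>lborel)"
        by simp
    qed
    also have "\<dots> = ennreal \<bar>c\<bar> * (\<integral>\<^sup>+a. \<integral>\<^sup>+b. f a b \<partial>lborel \<partial>lborel)"
      by (rule nn_integral_cmult) measurable
    also have "(\<integral>\<^sup>+a. \<integral>\<^sup>+b. f a b \<partial>lborel \<partial>lborel) = ?R" using fub[of f] by simp
    finally show ?thesis using False by (simp add: ennreal_mult_cancel_left)
  qed
qed

text \<open>A map that commutes with updates of the integrated coordinates acts on the fixed outer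
  coordinates only, so it can be applied to the base point \<open>z\<close>.\<close>

lemma iint_comp_outer:
  assumes "\<And>i x t. i < m \<Longrightarrow> R (x(i := t)) = (R x)(i := t)"
  shows "iint m (\<lambda>x. g (R x)) z = iint m g (R z)"
  using assms by (induction m arbitrary: z) auto

text \<open>Outer integrals are peeled off until the two outermost ones span the rotated plane.
  There the planar substitution applies, because the inner integrals see the rotation only through
  the outer values.\<close>

lemma iint_rot:
  assumes [measurable]: "g \<in> borel_measurable RN" and "Suc i < m" and cs: "c\<^sup>2 + s\<^sup>2 = 1"
  shows "iint m (\<lambda>x. g (rot i c s x)) z = iint m g z"
  using \<open>Suc i < m\<close>
proof (induction m arbitrary: z)
  case (Suc m)
  show ?case
  proof (cases "Suc i = m")
    case True
    have *: "iint i (\<lambda>x. g (rot i c s x)) (z(Suc i := t, i := u))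
        = iint i g (z(Suc i := s * u + c * t, i := c * u - s * t))" for t u
    proof -
      have "iint i (\<lambda>x. g (rot i c s x)) (z(Suc i := t, i := u)) = iint i g (rot i c s (z(Suc i := t, i := u)))"
        by (rule iint_comp_outer) (auto simp: rot_def fun_eq_iff)
      also have "rot i c s (z(Suc i := t, i := u)) = z(Suc i := s * u + c * t, i := c * u - s * t)"
        by (auto simp: rot_def fun_eq_iff)
      finally show ?thesis .
    qed
    show ?thesis unfolding True[symmetric]
      using nn_integral_rotation[OF _ cs, of "\<lambda>a b. iint i g (z(Suc i := b, i := a))"]
      by (simp add: *)
  next
    case False
    then show ?thesis using Suc by simp
  qed
qed simp

definition flip :: "nat \<Rightarrow> (nat \<Rightarrow> real) \<Rightarrow> nat \<Rightarrow> real" where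
  "flip m x = (\<lambda>i. if i < m then - x i else x i)"

lemma iint_flip:
  assumes "g \<in> borel_measurable RN"
  shows "iint m (\<lambda>x. g (flip m x)) z = iint m g z"
  using assms
proof (induction m arbitrary: z g)
  case 0 then show ?case by (simp add: flip_def)
next
  case (Suc m)
  note [measurable] = Suc.prems
  have "flip (Suc m) x = (flip m x)(m := - (flip m x) m)" for x
    by (auto simp: flip_def fun_eq_iff less_Suc_eq)
  then have "iint (Suc m) (\<lambda>x. g (flip (Suc m) x)) z
      = (\<integral>\<^sup>+t. iint m (\<lambda>x. g (x(m := - x m))) (z(m := t)) \<partial>lborel)"
    using Suc.IH[of "\<lambda>x. g (x(m := - x m))"] by simp
  also have "\<dots> = (\<integral>\<^sup>+t. iint m g (z(m := 0 + (- 1) * t)) \<partial>lborel)"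
  proof (rule nn_integral_cong)
    fix t
    have "iint m (\<lambda>x. g (x(m := - x m))) (z(m := t)) = iint m g ((z(m := t))(m := - (z(m := t)) m))"
      by (rule iint_comp_outer) (auto simp: fun_eq_iff)
    then show "iint m (\<lambda>x. g (x(m := - x m))) (z(m := t)) = iint m g (z(m := 0 + (- 1) * t))" by simp
  qed
  also have "\<dots> = iint (Suc m) g z"
    using nn_integral_real_affine[of "\<lambda>t. iint m g (z(m := t))" "- 1" 0] by simp
  finally show ?case .
qed

subsection \<open>Average error of adaptive measurements\<close>

lemma ip_measurable [measurable]: "(\<lambda>x. ip m x x) \<in> borel_measurable RN"
  unfolding ip_def by measurable

text \<open>On \<open>D\<close>, some tree of \<open>k\<close> adaptive linear measurements exists such that any two points with equal
  outcomes satisfy the triangle inequality that the errors \<open>g\<close> of a common answer must satisfy.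
  No measurability is required of the tree.\<close>

primrec resolves :: "nat \<Rightarrow> real \<Rightarrow> nat \<Rightarrow> (nat \<Rightarrow> real) set \<Rightarrow> ((nat \<Rightarrow> real) \<Rightarrow> ennreal) \<Rightarrow> bool" where
  "resolves M s 0 D g \<longleftrightarrow>
     (\<forall>x\<in>D. \<forall>y\<in>D. ennreal (s * sqrt (ip M (\<lambda>i. x i - y i) (\<lambda>i. x i - y i))) \<le> g x + g y)"
| "resolves M s (Suc k) D g \<longleftrightarrow> (\<exists>a. \<forall>c. resolves M s k (D \<inter> {x. ip M a x = c}) g)"

lemma flip_measurable [measurable]: "flip m \<in> measurable RN RN"
  unfolding flip_def by (rule measurable_PiM_single') auto

lemma resolves_mono: "resolves M s k D g \<Longrightarrow> D' \<subseteq> D \<Longrightarrow> resolves M s k D' g"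
proof (induction k arbitrary: D D')
  case 0 then show ?case by (simp, blast)
next
  case (Suc k)
  then obtain a where a: "\<And>c. resolves M s k (D \<inter> {x. ip M a x = c}) g" by auto
  have "resolves M s k (D' \<inter> {x. ip M a x = c}) g" for c
    using Suc.IH[OF a[of c], of "D' \<inter> {x. ip M a x = c}"] Suc.prems(2) by blast
  then show ?case by auto
qed

text \<open>Rotating the points amounts to rotating every functional of the tree backwards, because
  the adjoint of a rotation is the opposite rotation; distances do not change.\<close>

lemma resolves_rot:
  assumes "Suc i < M" "c\<^sup>2 + s\<^sup>2 = 1"
  shows "resolves M r k D g \<Longrightarrow> resolves M r k {x. rot i c s x \<in> D} (\<lambda>x. g (rot i c s x))"
proof (induction k arbitrary: D)
  case 0
  have eq: "ip M (\<lambda>j. rot i c s x j - rot i c s y j) (\<lambda>j. rot i c s x j - rot i c s y j)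
      = ip M (\<lambda>j. x j - y j) (\<lambda>j. x j - y j)" for x y
    by (simp only: rot_diff[symmetric] ip_rot[OF assms])
  show ?case unfolding resolves.simps
  proof safe
    fix x y assume "rot i c s x \<in> D" "rot i c s y \<in> D"
    from 0[unfolded resolves.simps, rule_format, OF this]
    show "ennreal (r * sqrt (ip M (\<lambda>i. x i - y i) (\<lambda>i. x i - y i))) \<le> g (rot i c s x) + g (rot i c s y)"
      by (simp only: eq)
  qed
next
  case (Suc k)
  then obtain a where a: "\<And>e. resolves M r k (D \<inter> {x. ip M a x = e}) g" by auto
  have "{x. rot i c s x \<in> D} \<inter> {x. ip M (rot i c (- s) a) x = e} = {x. rot i c s x \<in> D \<inter> {x. ip M a x = e}}"
    for e using ip_rot_adjoint[OF assms(1)] by auto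
  then have "resolves M r k ({x. rot i c s x \<in> D} \<inter> {x. ip M (rot i c (- s) a) x = e}) (\<lambda>x. g (rot i c s x))"
    for e using Suc.IH[OF a[of e]] by simp
  then show ?case by auto
qed

text \<open>The signs fit \<open>rot p c (- s) a\<close>, the functional \<open>a\<close> after a
  rotation of its argument: its coordinate \<open>p\<close> is
  \<open>c * a p + s * a (Suc p)\<close>.\<close>

lemma rotate_coordinate_away:
  fixes a b :: real
  obtains c s where "c\<^sup>2 + s\<^sup>2 = 1" "c * a + s * b = 0"
proof (cases "a = 0 \<and> b = 0")
  case True then show ?thesis using that[of 1 0] by simp
next
  case False
  define r where "r = sqrt (a\<^sup>2 + b\<^sup>2)"
  have "a\<^sup>2 + b\<^sup>2 > 0" using False by (simp add: sum_power2_gt_zero_iff)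
  then have "r > 0" "r\<^sup>2 = a\<^sup>2 + b\<^sup>2" by (auto simp: r_def)
  then show ?thesis using that[of "b / r" "- a / r"] \<open>a\<^sup>2 + b\<^sup>2 > 0\<close>
    by (simp add: power_divide add_divide_distrib[symmetric] add.commute False)
qed

text \<open>Rotate until the first functional reads off the last coordinate, and use Fubini: each slice is a
  rotation invariant problem with one measurement and one dimension less. Without measurements left,
  pairing \<open>x\<close> with its reflection gives the claim.\<close>

lemma resolves_iint_lower:
  assumes "resolves M s k {x. \<forall>j\<ge>m. x j = z j} g" "k \<le> m" "m \<le> M" "s \<ge> 0"
    and "g \<in> borel_measurable RN" and [measurable]: "w \<in> borel_measurable borel"
  shows "iint m (\<lambda>x. ennreal (s * sqrt (ip (m - k) x x)) * w (ip M x x)) z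
       \<le> iint m (\<lambda>x. g x * w (ip M x x)) z"
  using assms(1-3,5)
proof (induction k arbitrary: m z g)
  case 0
  note [measurable] = \<open>g \<in> borel_measurable RN\<close>
  let ?W = "\<lambda>x. w (ip M x x)"
  have ipf: "ip M (flip m x) (flip m x) = ip M x x" for x
    unfolding ip_def flip_def by (intro sum.cong) auto
  \<comment> \<open>The points \<open>x\<close> and \<open>flip m x\<close> lie in the same slice
    and differ by twice the first \<open>m\<close> coordinates of \<open>x\<close>.\<close>
  have le: "2 * ennreal (s * sqrt (ip m x x)) \<le> g x + g (flip m x)" if "\<And>i. i \<ge> m \<Longrightarrow> x i = z i" for x
  proof -
    have "ip M (\<lambda>i. x i - flip m x i) (\<lambda>i. x i - flip m x i) = (\<Sum>i<M. if i < m then 4 * (x i * x i) else 0)"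
      unfolding ip_def flip_def by (intro sum.cong) auto
    also have "\<dots> = (\<Sum>i<m. 4 * (x i * x i))"
      using \<open>m \<le> M\<close> by (subst sum.inter_filter[symmetric]) (auto intro!: sum.cong)
    finally have "ip M (\<lambda>i. x i - flip m x i) (\<lambda>i. x i - flip m x i) = 4 * ip m x x"
      by (simp add: ip_def sum_distrib_left)
    moreover have "x \<in> {x. \<forall>j\<ge>m. x j = z j}" "flip m x \<in> {x. \<forall>j\<ge>m. x j = z j}"
      using that by (simp_all add: flip_def)
    note 0(1)[unfolded resolves.simps, rule_format, OF this]
    moreover have "ennreal (2 * (s * sqrt (ip m x x))) = 2 * ennreal (s * sqrt (ip m x x))"
      by (simp add: ennreal_mult')
    ultimately show ?thesis by (simp add: real_sqrt_mult mult.left_commute)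
  qed
  have "2 * iint m (\<lambda>x. ennreal (s * sqrt (ip (m - 0) x x)) * ?W x) z
      = iint m (\<lambda>x. 2 * (ennreal (s * sqrt (ip m x x)) * ?W x)) z"
    unfolding diff_zero by (rule iint_cmult[symmetric]) measurable
  also have "\<dots> \<le> iint m (\<lambda>x. g x * ?W x + g (flip m x) * ?W (flip m x)) z"
  proof (rule iint_mono)
    fix x assume "\<And>i. i \<ge> m \<Longrightarrow> x i = z i"
    from mult_right_mono[OF le[OF this], of "?W x"]
    show "2 * (ennreal (s * sqrt (ip m x x)) * ?W x) \<le> g x * ?W x + g (flip m x) * ?W (flip m x)"
      by (simp add: ipf distrib_right mult.assoc)
  qed
  also have "\<dots> = iint m (\<lambda>x. g x * ?W x) z + iint m (\<lambda>x. g (flip m x) * ?W (flip m x)) z"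
    by (rule iint_add) measurable
  also have "iint m (\<lambda>x. g (flip m x) * ?W (flip m x)) z = iint m (\<lambda>x. g x * ?W x) z"
    by (rule iint_flip[of "\<lambda>x. g x * ?W x"]) measurable
  also have "iint m (\<lambda>x. g x * ?W x) z + iint m (\<lambda>x. g x * ?W x) z = 2 * iint m (\<lambda>x. g x * ?W x) z"
    by (simp add: mult_2)
  finally show ?case by (simp add: ennreal_mult_le_mult_iff)
next
  case (Suc k)
  then obtain m' where m: "m = Suc m'" "k \<le> m'" "m' < M" by (cases m) auto
  let ?D = "{x. \<forall>j\<ge>m. x j = z j}"
  let ?L = "iint m (\<lambda>x. ennreal (s * sqrt (ip (m - Suc k) x x)) * w (ip M x x)) z"
  \<comment> \<open>Here \<open>p\<close> counts leading coordinates on which the first functional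
    already vanishes. The error function is generalised too, since every rotation is absorbed into
    \<open>g\<close>.\<close>
  have key: "?L \<le> iint m (\<lambda>x. g x * w (ip M x x)) z"
    if "p \<le> m'" "\<And>i. i < p \<Longrightarrow> a i = 0" "\<And>c. resolves M s k (?D \<inter> {x. ip M a x = c}) g"
      "g \<in> borel_measurable RN" for p a g
    using that
  proof (induction "m' - p" arbitrary: p a g)
    case 0
    then have p: "p = m'" by simp
    \<comment> \<open>The functional now sees only coordinates from \<open>m'\<close> on, which the
      slice fixes, so its outcome is constant there and the remaining tree of \<open>k\<close>
      measurements applies. The weight still uses all \<open>M\<close> coordinates and thus stays
      the same function in every slice.\<close>
    have "iint m' (\<lambda>x. ennreal (s * sqrt (ip (m' - k) x x)) * w (ip M x x)) (z(m' := t))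
        \<le> iint m' (\<lambda>x. g x * w (ip M x x)) (z(m' := t))" for t
    proof (rule Suc.IH)
      have ipz: "ip M a x = ip M a (z(m' := t))" if "\<forall>j\<ge>m'. x j = (z(m' := t)) j" for x
        unfolding ip_def using 0(3) p that by (intro sum.cong refl) (metis mult_zero_left not_le)
      have "{x. \<forall>j\<ge>m'. x j = (z(m' := t)) j} \<subseteq> ?D \<inter> {x. ip M a x = ip M a (z(m' := t))}"
      proof (intro subsetI IntI CollectI allI impI)
        fix x assume "x \<in> {x. \<forall>j\<ge>m'. x j = (z(m' := t)) j}"
        then have x: "\<forall>j\<ge>m'. x j = (z(m' := t)) j" by simp
        from this show "ip M a x = ip M a (z(m' := t))" by (rule ipz)
        show "x j = z j" if "j \<ge> m" for j using x[rule_format, of j] that m(1) by simp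
      qed
      then show "resolves M s k {x. \<forall>j\<ge>m'. x j = (z(m' := t)) j} g"
        by (rule resolves_mono[OF 0(4)])
    qed (use m 0 in auto)
    then show ?case unfolding m(1) by (simp add: nn_integral_mono)
  next
    case (Suc d)
    then have p: "p < m'" by simp
    then have pM: "Suc p < M" "Suc p < m" using m by auto
    note [measurable] = \<open>g \<in> borel_measurable RN\<close>
    obtain c t where ct: "c\<^sup>2 + t\<^sup>2 = 1" "c * a p + t * a (Suc p) = 0" by (rule rotate_coordinate_away)
    have "?L \<le> iint m (\<lambda>x. g (rot p c t x) * w (ip M x x)) z"
    proof (rule Suc.hyps(1)[of "Suc p" "rot p c (- t) a"])
      show "rot p c (- t) a i = 0" if "i < Suc p" for i
        using that Suc.prems(2)[of i] ct(2) by (auto simp: rot_def less_Suc_eq)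
      fix e
      have "{x. rot p c t x \<in> ?D \<inter> {x. ip M a x = e}} = ?D \<inter> {x. ip M (rot p c (- t) a) x = e}"
        using pM ip_rot_adjoint[OF pM(1)] by (auto simp: rot_other)
      then show "resolves M s k (?D \<inter> {x. ip M (rot p c (- t) a) x = e}) (\<lambda>x. g (rot p c t x))"
        using resolves_rot[OF pM(1) ct(1) Suc.prems(3)[of e]] by simp
    qed (use Suc.hyps(2) p in auto)
    also have "\<dots> = iint m (\<lambda>x. g (rot p c t x) * w (ip M (rot p c t x) (rot p c t x))) z"
      using pM ct by (simp add: ip_rot)
    also have "\<dots> = iint m (\<lambda>x. g x * w (ip M x x)) z"
      using pM ct by (intro iint_rot[of "\<lambda>x. g x * w (ip M x x)"]) auto
    finally show ?case .
  qed
  obtain a where "\<And>c. resolves M s k (?D \<inter> {x. ip M a x = c}) g" using Suc.prems(1) by auto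
  then show ?case using key[of 0 a g] Suc.prems by simp
qed

section \<open>Mass and projections on a thin spherical shell\<close>

lemma iint_box_lower:
  assumes "\<And>x. (\<And>i. i < m \<Longrightarrow> a \<le> x i \<and> x i \<le> b) \<Longrightarrow> (\<And>i. i \<ge> m \<Longrightarrow> x i = z i) \<Longrightarrow> 1 \<le> g x" "a \<le> b"
  shows "ennreal ((b - a) ^ m) \<le> iint m g z"
  using assms
proof (induction m arbitrary: z)
  case 0 then show ?case by simp
next
  case (Suc m)
  have "ennreal ((b - a) ^ Suc m) = (\<integral>\<^sup>+t. ennreal ((b - a) ^ m) * indicator {a..b} t \<partial>lborel)"
    using Suc.prems(2) by (simp add: nn_integral_cmult_indicator ennreal_mult mult.commute[of "b - a"])
  also have "\<dots> \<le> (\<integral>\<^sup>+t. iint m g (z(m := t)) \<partial>lborel)"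
  proof (rule nn_integral_mono)
    fix t
    show "ennreal ((b - a) ^ m) * indicator {a..b} t \<le> iint m g (z(m := t))"
    proof (cases "t \<in> {a..b}")
      case True
      have "ennreal ((b - a) ^ m) \<le> iint m g (z(m := t))"
      proof (rule Suc.IH[OF _ Suc.prems(2)])
        fix x assume x: "\<And>i. i < m \<Longrightarrow> a \<le> x i \<and> x i \<le> b" "\<And>i. i \<ge> m \<Longrightarrow> x i = (z(m := t)) i"
        have "x m = t" using x(2)[of m] by simp
        then show "1 \<le> g x" using x True by (intro Suc.prems(1)) (auto simp: less_Suc_eq)
      qed
      then show ?thesis using True by simp
    qed simp
  qed
  finally show ?case by simp
qed

lemma iint_box_finite:
  assumes "\<And>x. (\<And>i. i \<ge> m \<Longrightarrow> x i = z i) \<Longrightarrow> g x \<le> 1"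
    and "\<And>x i. i < m \<Longrightarrow> x i \<notin> {a..b} \<Longrightarrow> g x = 0" "a \<le> b"
  shows "iint m g z \<le> ennreal ((b - a) ^ m)"
  using assms
proof (induction m arbitrary: z)
  case 0 then show ?case by simp
next
  case (Suc m)
  have z0: "iint m (\<lambda>x. 0) z = 0" for z by (induction m arbitrary: z) auto
  have "(\<integral>\<^sup>+t. iint m g (z(m := t)) \<partial>lborel) \<le> (\<integral>\<^sup>+t. ennreal ((b - a) ^ m) * indicator {a..b} t \<partial>lborel)"
  proof (rule nn_integral_mono)
    fix t
    show "iint m g (z(m := t)) \<le> ennreal ((b - a) ^ m) * indicator {a..b} t"
    proof (cases "t \<in> {a..b}")
      case True
      have "iint m g (z(m := t)) \<le> ennreal ((b - a) ^ m)"
      proof (rule Suc.IH)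
        show "g x \<le> 1" if "\<And>i. i \<ge> m \<Longrightarrow> x i = (z(m := t)) i" for x
          using that by (intro Suc.prems(1)) auto
        show "g x = 0" if "i < m" "x i \<notin> {a..b}" for x i
          using that by (intro Suc.prems(2)[of i x]) auto
      qed (rule Suc.prems(3))
      then show ?thesis using True by simp
    next
      case False
      have "iint m g (z(m := t)) \<le> iint m (\<lambda>x. 0) (z(m := t))"
      proof (rule iint_mono)
        fix x assume "\<And>i. i \<ge> m \<Longrightarrow> x i = (z(m := t)) i"
        then have "x m = t" by simp
        then show "g x \<le> 0" using Suc.prems(2)[of m x] False by simp
      qed
      then show ?thesis using z0 False by simp
    qed
  qed
  also have "\<dots> = ennreal ((b - a) ^ Suc m)"
    using Suc.prems(3) by (simp add: nn_integral_cmult_indicator ennreal_mult mult.commute[of "b - a"])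
  finally show ?case by simp
qed

text \<open>A shell of positive Lebesgue measure, given through squared radii, takes the place of
  the sphere. Half of its threshold 24/25 becomes the factor 12/25; the general case with constant
  12 requires at least \<open>sqrt 2 / 3\<close> there.\<close>

definition shell :: "real \<Rightarrow> ennreal" where
  "shell = indicator {24/25..1}"

lemma shell_measurable [measurable]: "shell \<in> borel_measurable borel"
  unfolding shell_def by measurable

text \<open>The cube with coordinates between \<open>sqrt (24/25 / m)\<close> and
  \<open>sqrt (1 / m)\<close> lies in the shell, and the shell lies in the cube of coordinates
  between -1 and 1. Both bounds together allow the mass to be cancelled later.\<close>

lemma shell_mass:
  assumes "m > 0"
  shows "0 < iint m (\<lambda>x. shell (ip m x x)) z" "iint m (\<lambda>x. shell (ip m x x)) z < \<top>"
proof -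
  let ?a = "sqrt (24/25 / real m)" and ?b = "sqrt (1 / real m)"
  have ab: "?a < ?b" using assms by (simp add: field_simps)
  have "ennreal ((?b - ?a) ^ m) \<le> iint m (\<lambda>x. shell (ip m x x)) z"
  proof (rule iint_box_lower)
    fix x :: "nat \<Rightarrow> real" assume x: "\<And>i. i < m \<Longrightarrow> ?a \<le> x i \<and> x i \<le> ?b"
    have "24/25 / real m \<le> x i * x i \<and> x i * x i \<le> 1 / real m" if "i < m" for i
    proof -
      have "0 \<le> ?a" by simp
      then have "0 \<le> x i" using x[OF that] by linarith
      have "?a * ?a \<le> x i * x i" by (rule mult_mono) (use x[OF that] \<open>0 \<le> x i\<close> in auto)
      moreover have "x i * x i \<le> ?b * ?b" by (rule mult_mono) (use x[OF that] \<open>0 \<le> x i\<close> in auto)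
      ultimately show ?thesis by simp
    qed
    then have "(\<Sum>i<m. 24/25 / real m) \<le> ip m x x \<and> ip m x x \<le> (\<Sum>i<m. 1 / real m)"
      unfolding ip_def by (intro conjI sum_mono) auto
    then show "1 \<le> shell (ip m x x)" using assms by (simp add: shell_def)
  qed (use ab in simp)
  moreover have "0 < (?b - ?a) ^ m" using ab by simp
  ultimately show "0 < iint m (\<lambda>x. shell (ip m x x)) z"
    by (meson ennreal_less_zero_iff less_le_trans)
  have "iint m (\<lambda>x. shell (ip m x x)) z \<le> ennreal ((1 - (-1)) ^ m)"
  proof (rule iint_box_finite)
    show "shell (ip m x x) \<le> 1" for x by (simp add: shell_def indicator_def)
    show "shell (ip m x x) = 0" if "i < m" "x i \<notin> {-1..1}" for x i
    proof -
      have "1 < \<bar>x i\<bar>" using that(2) by auto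
      then have "1 < (x i)\<^sup>2" using power_strict_mono[of 1 "\<bar>x i\<bar>" 2] by simp
      also have "\<dots> \<le> ip m x x" unfolding ip_def power2_eq_square using that(1)
        by (intro member_le_sum[of i "{..<m}" "\<lambda>i. x i * x i"]) auto
      finally show ?thesis by (simp add: shell_def)
    qed
  qed simp
  then show "iint m (\<lambda>x. shell (ip m x x)) z < \<top>"
    by (metis ennreal_less_top le_less_trans)
qed

text \<open>All \<open>2 * k + 1\<close> coordinates have the same second moment, so the first
  \<open>k + 1\<close> carry at least half of the squared norm, which is at least 24/25 on the
  shell. Passing to the length costs nothing, as \<open>t \<le> sqrt t\<close> for \<open>t\<close>
  between 0 and 1.\<close>

lemma shell_projection:
  assumes m: "m = 2 * k + 1"
  shows "ennreal (24/25) * iint m (\<lambda>x. shell (ip m x x)) z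
       \<le> 2 * iint m (\<lambda>x. ennreal (sqrt (ip (Suc k) x x)) * shell (ip m x x)) z"
proof -
  define J where "J i = iint m (\<lambda>x. ennreal ((x i)\<^sup>2) * shell (ip m x x)) z" for i
  have [measurable]: "(\<lambda>x. ennreal ((x i)\<^sup>2) * shell (ip m x x)) \<in> borel_measurable RN" for i
    by measurable
  \<comment> \<open>A quarter turn exchanges neighbouring coordinates up to sign and preserves the
    shell.\<close>
  have "J (Suc i) = J i" if "Suc i < m" for i
  proof -
    have r: "rot i 0 1 x i = - x (Suc i)" for x by (simp add: rot_def)
    have "J i = iint m (\<lambda>x. ennreal ((rot i 0 1 x i)\<^sup>2) * shell (ip m (rot i 0 1 x) (rot i 0 1 x))) z"
      unfolding J_def using that
      by (intro iint_rot[of "\<lambda>x. ennreal ((x i)\<^sup>2) * shell (ip m x x)", symmetric]) auto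
    then show ?thesis using that by (simp add: ip_rot r J_def)
  qed
  then have J0: "i < m \<Longrightarrow> J i = J 0" for i by (induction i) auto
  have sumJ: "iint m (\<lambda>x. ennreal (ip n x x) * shell (ip m x x)) z = of_nat n * J 0" if "n \<le> m" for n
  proof -
    have "ennreal (ip n x x) * shell (ip m x x) = (\<Sum>i<n. ennreal ((x i)\<^sup>2) * shell (ip m x x))" for x
      unfolding ip_def by (subst sum_distrib_right[symmetric], subst sum_ennreal) (auto simp: power2_eq_square)
    then have "iint m (\<lambda>x. ennreal (ip n x x) * shell (ip m x x)) z = (\<Sum>i<n. J i)"
      by (simp add: iint_sum J_def)
    also have "\<dots> = (\<Sum>i<n. J 0)" 
      by (rule sum.cong[OF refl], rule J0) (use that in auto)
    finally show ?thesis by simp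
  qed
  let ?C = "iint m (\<lambda>x. ennreal (sqrt (ip (Suc k) x x)) * shell (ip m x x)) z"
  have "ennreal (24/25) * iint m (\<lambda>x. shell (ip m x x)) z = iint m (\<lambda>x. ennreal (24/25) * shell (ip m x x)) z"
    by (rule iint_cmult[symmetric]) measurable
  also have "\<dots> \<le> iint m (\<lambda>x. ennreal (ip m x x) * shell (ip m x x)) z"
    by (rule iint_mono) (auto simp: shell_def indicator_def intro!: ennreal_leI)
  also have "\<dots> = of_nat m * J 0" by (rule sumJ) simp
  also have "\<dots> \<le> of_nat (2 * Suc k) * J 0" using m by (intro mult_right_mono of_nat_mono) auto
  also have "\<dots> = 2 * (of_nat (Suc k) * J 0)" 
    by (simp only: of_nat_mult of_nat_numeral mult.assoc)
  also have "of_nat (Suc k) * J 0 = iint m (\<lambda>x. ennreal (ip (Suc k) x x) * shell (ip m x x)) z"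
    using m by (intro sumJ[symmetric]) simp
  finally have "ennreal (24/25) * iint m (\<lambda>x. shell (ip m x x)) z
      \<le> 2 * iint m (\<lambda>x. ennreal (ip (Suc k) x x) * shell (ip m x x)) z" .
  moreover have "iint m (\<lambda>x. ennreal (ip (Suc k) x x) * shell (ip m x x)) z \<le> ?C"
  proof (rule iint_mono)
    fix x :: "nat \<Rightarrow> real"
    have "ip (Suc k) x x \<le> sqrt (ip (Suc k) x x)" if "ip m x x \<le> 1"
    proof -
      have "ip (Suc k) x x \<le> ip m x x" unfolding ip_def using m by (intro sum_mono2) auto
      then have "ip (Suc k) x x * ip (Suc k) x x \<le> 1 * ip (Suc k) x x"
        using that ip_self_nonneg[of "Suc k" x] by (intro mult_right_mono) auto
      then show ?thesis by (intro real_le_rsqrt) (simp add: power2_eq_square)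
    qed
    then show "ennreal (ip (Suc k) x x) * shell (ip m x x) \<le> ennreal (sqrt (ip (Suc k) x x)) * shell (ip m x x)"
      by (auto simp: shell_def indicator_def intro!: ennreal_leI)
  qed
  ultimately show ?thesis by (meson mult_left_mono order_trans zero_le)
qed

section \<open>From adaptive algorithms to a lower bound for the randomized error\<close>

lemma length_info: "length (info L k f) = k"
  by (induction k) auto

text \<open>Once the history \<open>ys\<close> is known, the next functional is fixed; on the affine
  subspace it is the inner product with the vector of the values \<open>L j ys (u l)\<close>,
  shifted by \<open>L j ys p\<close>. The induction runs over the number \<open>i\<close> of
  measurements still to come.\<close>

lemma adaptive_info_resolves:
  assumes L: "\<And>j ys. j < k \<Longrightarrow> length ys = j \<Longrightarrow> bounded_linear (L j ys)"
    and g: "\<And>x y. info L k (p + (\<Sum>l<m. x l *\<^sub>R u l)) = info L k (p + (\<Sum>l<m. y l *\<^sub>R u l)) \<Longrightarrow>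
      ennreal (s * sqrt (ip m (\<lambda>i. x i - y i) (\<lambda>i. x i - y i))) \<le> g x + g y"
  shows "resolves m s k UNIV g"
proof -
  let ?i = "\<lambda>x. p + (\<Sum>l<m. x l *\<^sub>R u l)"
  have "resolves m s i {x. info L j (?i x) = ys} g" if "i + j = k" for i j ys
    using that
  proof (induction i arbitrary: j ys)
    case 0
    then show ?case by (simp add: g)
  next
    case (Suc i)
    have "resolves m s i ({x. info L j (?i x) = ys} \<inter> {x. ip m (\<lambda>l. L j ys (u l)) x = c}) g" for c
    proof (rule resolves_mono)
      show "resolves m s i {x. info L (Suc j) (?i x) = ys @ [L j ys p + c]} g"
        using Suc by (intro Suc.IH) simp
      show "{x. info L j (?i x) = ys} \<inter> {x. ip m (\<lambda>l. L j ys (u l)) x = c}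
          \<subseteq> {x. info L (Suc j) (?i x) = ys @ [L j ys p + c]}"
      proof
        fix x assume "x \<in> {x. info L j (?i x) = ys} \<inter> {x. ip m (\<lambda>l. L j ys (u l)) x = c}"
        then have x: "ys = info L j (?i x)" "c = ip m (\<lambda>l. L j ys (u l)) x" by auto
        have "length ys = j" using x(1) by (simp add: length_info)
        then interpret bounded_linear "L j ys" using Suc.prems by (intro L) auto
        have "L j ys (?i x) = L j ys p + c"
          unfolding x(2) ip_def by (simp add: add sum scaleR mult.commute)
        then show "x \<in> {x. info L (Suc j) (?i x) = ys @ [L j ys p + c]}" using x(1) by simp
      qed
    qed
    then show ?case by auto
  qed
  from this[of k 0 "[]"] show ?thesis by simp
qed

lemma FF_seminorm_le:
  assumes "t > 0" "x = t *\<^sub>R (a - b)" "a \<in> F" "b \<in> F"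
  shows "FF_seminorm F x \<le> ennreal t"
  unfolding FF_seminorm_def using assms by (intro INF_lower) auto

text \<open>A parameter difference shorter than \<open>r\<close> is mapped into
  \<open>t * (F - F)\<close> for some \<open>t < r\<close>, so the embedding is continuous for the
  seminorm. Parameters outside the ball are sent to \<open>p\<close> to make the map total.\<close>

lemma measurable_embedding_BF:
  fixes u :: "nat \<Rightarrow> 'a::real_normed_vector"
  assumes F: "\<And>x. ip m x x \<le> 1 \<Longrightarrow> p + (\<Sum>j<m. x j *\<^sub>R u j) \<in> F"
  shows "(\<lambda>x. if ip m x x \<le> 1 then p + (\<Sum>j<m. x j *\<^sub>R u j) else p) \<in> measurable RN (BF F)"
    (is "?f \<in> _")
proof -
  let ?i = "\<lambda>x. p + (\<Sum>j<m. x j *\<^sub>R u j)"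
  have p: "p \<in> F" using F[of "\<lambda>_. 0"] by (simp add: ip_def)
  have near: "FF_seminorm F (?i y - ?i x) < ennreal r"
    if r: "r > 0" "ip m (\<lambda>i. y i - x i) (\<lambda>i. y i - x i) < r\<^sup>2" for x y r
  proof -
    define d where "d = (\<lambda>i. y i - x i)"
    have "sqrt (ip m d d) < r" using r by (simp add: d_def real_less_lsqrt)
    then obtain t where t: "sqrt (ip m d d) < t" "t < r" using dense by blast
    have "0 \<le> sqrt (ip m d d)" by (simp add: ip_self_nonneg)
    then have t0: "t > 0" using t(1) by linarith
    have "ip m (\<lambda>i. inverse t * d i) (\<lambda>i. inverse t * d i) = ip m d d / t\<^sup>2"
      unfolding ip_def by (simp add: sum_divide_distrib power2_eq_square field_simps)
    also have "\<dots> \<le> 1"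
      using t(1) t0 by (simp add: sqrt_le_D less_imp_le)
    finally have a: "?i (\<lambda>i. inverse t * d i) \<in> F" by (rule F)
    have "t *\<^sub>R (?i (\<lambda>i. inverse t * d i) - p) = (\<Sum>j<m. d j *\<^sub>R u j)"
      using t0 by (simp add: scaleR_sum_right mult.assoc[symmetric])
    also have "\<dots> = ?i y - ?i x" by (simp add: d_def scaleR_diff_left sum_subtractf)
    finally have "FF_seminorm F (?i y - ?i x) \<le> ennreal t"
      using FF_seminorm_le[OF t0 _ a p] by simp
    also have "\<dots> < ennreal r" using t t0 by (simp add: ennreal_lessI)
    finally show ?thesis .
  qed
  show ?thesis unfolding BF_def
  proof (rule measurable_measure_of)
    show "?f \<in> space RN \<rightarrow> F" using F p by auto
    fix U assume "U \<in> {U. U \<subseteq> F \<and> (\<forall>f\<in>U. \<exists>r::real. 0 < r \<and> {g \<in> F. FF_seminorm F (g - f) < ennreal r} \<subseteq> U)}"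
    then have U: "\<And>f. f \<in> U \<Longrightarrow> \<exists>r::real. 0 < r \<and> {g \<in> F. FF_seminorm F (g - f) < ennreal r} \<subseteq> U" by blast
    then obtain r where r: "\<And>f. f \<in> U \<Longrightarrow> 0 < r f \<and> {g \<in> F. FF_seminorm F (g - f) < ennreal (r f)} \<subseteq> U"
      by metis
    \<comment> \<open>A union of open cylinders is open even if it is uncountable, so the radii
      \<open>r\<close> may be chosen arbitrarily; on the countable product, open sets belong to
      \<open>sets RN\<close>.\<close>
    define V where "V = (\<Union>x\<in>{x. ip m x x \<le> 1 \<and> ?i x \<in> U}. {y. ip m (\<lambda>i. y i - x i) (\<lambda>i. y i - x i) < (r (?i x))\<^sup>2})"
    have "open V" unfolding V_def ip_def
      by (intro open_UN ballI open_Collect_less continuous_intros continuous_on_product_coordinates)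
    then have "V \<in> sets borel" by (rule borel_open)
    then have [measurable]: "V \<in> sets RN" using sets_PiM_equal_borel by metis
    have "ip m y y \<le> 1 \<Longrightarrow> ?i y \<in> U \<longleftrightarrow> y \<in> V" for y
    proof
      assume "ip m y y \<le> 1" "?i y \<in> U"
      moreover have "ip m (\<lambda>i. y i - y i) (\<lambda>i. y i - y i) < (r (?i y))\<^sup>2"
        using r[OF \<open>?i y \<in> U\<close>] by (simp add: ip_def)
      ultimately show "y \<in> V" unfolding V_def by blast
    next
      assume y: "ip m y y \<le> 1" "y \<in> V"
      then obtain x where x: "?i x \<in> U" "ip m (\<lambda>i. y i - x i) (\<lambda>i. y i - x i) < (r (?i x))\<^sup>2"
        unfolding V_def by blast
      show "?i y \<in> U" using near[OF _ x(2)] r[OF x(1)] F[OF y(1)] by blast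
    qed
    then have "?f -` U \<inter> space RN = ({x. ip m x x \<le> 1} \<inter> V) \<union> (if p \<in> U then {x. \<not> ip m x x \<le> 1} else {})"
      by (auto split: if_splits)
    also have "{x. ip m x x \<le> 1} \<in> sets RN"
      using measurable_sets[OF ip_measurable[of m], of "{..1}"] by (simp add: vimage_def space_PiM)
    moreover have "{x. \<not> ip m x x \<le> 1} \<in> sets RN"
      using measurable_sets[OF ip_measurable[of m], of "{1<..}"] by (simp add: vimage_def space_PiM not_le)
    ultimately show "?f -` U \<inter> space RN \<in> sets RN" by auto
  qed auto
qed

text \<open>The worst case is at least the average over the shell. After Fubini this average is
  estimated for each fixed seed, where the algorithm is a deterministic tree of
  measurements.\<close>

lemma ran_err_lower:
  fixes S :: "'a::real_normed_vector \<Rightarrow> 'b::real_normed_vector" and M :: "'c measure"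
  assumes S: "bounded_linear S" and "s \<ge> 0" and m: "m = 2 * k + 1"
    and F: "\<And>x. ip m x x \<le> 1 \<Longrightarrow> p + (\<Sum>j<m. x j *\<^sub>R u j) \<in> F"
    and lower: "\<And>z. s * sqrt (ip m z z) \<le> norm (S (\<Sum>j<m. z j *\<^sub>R u j))"
    and A: "(M, A) \<in> ran_algs S F k"
  shows "ennreal (12/25 * s) \<le> ran_err S F M A"
proof -
  let ?i = "\<lambda>x. p + (\<Sum>j<m. x j *\<^sub>R u j)"
  define f where "f = (\<lambda>x. if ip m x x \<le> 1 then ?i x else p)"
  have prob: "prob_space M" and alg: "\<And>w. w \<in> space M \<Longrightarrow> A w \<in> adaptive_algs k"
    and meas: "(\<lambda>(f, w). norm (S f - A w f)) \<in> borel_measurable (BF F \<Otimes>\<^sub>M M)"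
    using A by (auto simp: ran_algs_def)
  interpret prob_space M by fact
  have f[measurable]: "f \<in> measurable RN (BF F)"
    unfolding f_def by (rule measurable_embedding_BF[OF F])
  have "(\<lambda>q. (f (fst q), snd q)) \<in> measurable (RN \<Otimes>\<^sub>M M) (BF F \<Otimes>\<^sub>M M)" by measurable
  from measurable_compose[OF this meas]
  have [measurable]: "(\<lambda>q. norm (S (f (fst q)) - A (snd q) (f (fst q)))) \<in> borel_measurable (RN \<Otimes>\<^sub>M M)"
    by simp
  \<comment> \<open>The value \<top> outside the ball makes the triangle inequality hold for all
    \<open>x\<close> and \<open>y\<close>, as \<open>resolves\<close> on \<open>UNIV\<close>
    demands; the shell weight is 0 at these points.\<close>
  define g where "g w x = (if ip m x x \<le> 1 then ennreal (norm (S (f x) - A w (f x))) else \<top>)" for w x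
  have [measurable]: "(\<lambda>q. ip m (fst q) (fst q)) \<in> borel_measurable (RN \<Otimes>\<^sub>M M)"
    using measurable_compose[OF measurable_fst ip_measurable] by simp
  have gm: "(\<lambda>q. g (snd q) (fst q)) \<in> borel_measurable (RN \<Otimes>\<^sub>M M)"
    unfolding g_def by measurable
  have gw: "g w \<in> borel_measurable RN" if "w \<in> space M" for w
    using measurable_compose[OF measurable_Pair2'[OF that] gm] by simp
  define I where "I = iint m (\<lambda>x. shell (ip m x x)) (\<lambda>_. 0)"
  define C where "C = iint m (\<lambda>x. ennreal (sqrt (ip (Suc k) x x)) * shell (ip m x x)) (\<lambda>_. 0)"
  have pointwise: "ennreal s * C \<le> iint m (\<lambda>x. g w x * shell (ip m x x)) (\<lambda>_. 0)" if w: "w \<in> space M" for w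
  proof -
    obtain L phi where L: "\<And>j ys. j < k \<Longrightarrow> length ys = j \<Longrightarrow> bounded_linear (L j ys)"
      and Aw: "A w = (\<lambda>f. phi (info L k f))"
      using alg[OF w] unfolding adaptive_algs_def by blast
    have "resolves m s k UNIV (g w)"
    proof (rule adaptive_info_resolves[OF L])
      fix x y assume eq: "info L k (?i x) = info L k (?i y)"
      show "ennreal (s * sqrt (ip m (\<lambda>i. x i - y i) (\<lambda>i. x i - y i))) \<le> g w x + g w y"
      proof (cases "ip m x x \<le> 1 \<and> ip m y y \<le> 1")
        case True
        interpret S: bounded_linear S by fact
        have "s * sqrt (ip m (\<lambda>i. x i - y i) (\<lambda>i. x i - y i)) \<le> norm (S (\<Sum>j<m. (x j - y j) *\<^sub>R u j))"
          by (rule lower)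
        also have "(\<Sum>j<m. (x j - y j) *\<^sub>R u j) = ?i x - ?i y"
          by (simp add: scaleR_diff_left sum_subtractf)
        also have "S \<dots> = (S (?i x) - A w (?i x)) - (S (?i y) - A w (?i y))"
          using eq by (simp add: Aw S.diff S.add)
        also have "norm \<dots> \<le> norm (S (?i x) - A w (?i x)) + norm (S (?i y) - A w (?i y))"
          by (rule norm_triangle_ineq4)
        finally show ?thesis using True
          by (simp add: g_def f_def ennreal_plus[symmetric] ennreal_leI del: ennreal_plus)
      qed (auto simp: g_def)
    qed auto
    then have "resolves m s k {x. \<forall>j\<ge>m. x j = 0} (g w)" by (rule resolves_mono) simp
    then have "iint m (\<lambda>x. ennreal (s * sqrt (ip (m - k) x x)) * shell (ip m x x)) (\<lambda>_. 0)
       \<le> iint m (\<lambda>x. g w x * shell (ip m x x)) (\<lambda>_. 0)"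
      using m \<open>s \<ge> 0\<close> gw[OF w] by (intro resolves_iint_lower) auto
    moreover have "m - k = Suc k" using m by simp
    moreover have "iint m (\<lambda>x. ennreal (s * sqrt (ip (Suc k) x x)) * shell (ip m x x)) (\<lambda>_. 0) = ennreal s * C"
      unfolding C_def using \<open>s \<ge> 0\<close>
      by (subst iint_cmult[symmetric]) (auto simp: ennreal_mult' ip_self_nonneg mult.assoc)
    ultimately show ?thesis by simp
  qed
  have [measurable]: "(\<lambda>(x, w). g w x * shell (ip m x x)) \<in> borel_measurable (RN \<Otimes>\<^sub>M M)"
    using gm by (simp add: case_prod_beta)
  have "ennreal s * C = (\<integral>\<^sup>+w. ennreal s * C \<partial>M)" by (simp add: emeasure_space_1)
  also have "\<dots> \<le> (\<integral>\<^sup>+w. iint m (\<lambda>x. g w x * shell (ip m x x)) (\<lambda>_. 0) \<partial>M)"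
    by (rule nn_integral_mono) (rule pointwise)
  also have "\<dots> = iint m (\<lambda>x. \<integral>\<^sup>+w. g w x * shell (ip m x x) \<partial>M) (\<lambda>_. 0)"
    by (rule iint_nn_integral_swap[symmetric]) (auto intro: sigma_finite_measure_axioms)
  also have "\<dots> \<le> iint m (\<lambda>x. ran_err S F M A * shell (ip m x x)) (\<lambda>_. 0)"
  proof (rule iint_mono)
    fix x
    show "(\<integral>\<^sup>+w. g w x * shell (ip m x x) \<partial>M) \<le> ran_err S F M A * shell (ip m x x)"
    proof (cases "ip m x x \<le> 1")
      case True
      have "?i x \<in> F" using F True by simp
      have xm: "(\<lambda>w. g w x) \<in> borel_measurable M"
        using measurable_compose[OF measurable_Pair1' gm, of x] by simp
      have "(\<integral>\<^sup>+w. g w x * shell (ip m x x) \<partial>M) = (\<integral>\<^sup>+w. g w x \<partial>M) * shell (ip m x x)"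
        by (rule nn_integral_multc[OF xm])
      also have "(\<integral>\<^sup>+w. g w x \<partial>M) \<le> ran_err S F M A"
        unfolding ran_err_def using \<open>?i x \<in> F\<close> True by (intro SUP_upper2[of "?i x"]) (auto simp: g_def f_def)
      finally show ?thesis by (simp add: mult_right_mono)
    qed (simp add: shell_def)
  qed
  also have "\<dots> = ran_err S F M A * I" unfolding I_def by (rule iint_cmult) measurable
  finally have sC: "ennreal s * C \<le> ran_err S F M A * I" .
  \<comment> \<open>Cancelling the positive finite mass \<open>I\<close> from the two estimates
    leaves half of 24/25 as the constant.\<close>
  have "ennreal (24/25) * I \<le> 2 * C" unfolding I_def C_def by (rule shell_projection[OF m])
  then have "ennreal s * (ennreal (24/25) * I) \<le> ennreal s * (2 * C)" by (intro mult_left_mono) auto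
  also have "\<dots> = 2 * (ennreal s * C)" by (simp add: mult.left_commute)
  also have "\<dots> \<le> 2 * (ran_err S F M A * I)" using sC by (intro mult_left_mono) auto
  finally have "I * (ennreal s * ennreal (24/25)) \<le> I * (2 * ran_err S F M A)" by (simp add: ac_simps)
  moreover have "0 < I" "I < \<top>" unfolding I_def using shell_mass[of m] m by auto
  ultimately have "ennreal s * ennreal (24/25) \<le> 2 * ran_err S F M A"
    by (simp add: ennreal_mult_le_mult_iff)
  moreover have "ennreal s * ennreal (24/25) = 2 * ennreal (12/25 * s)"
    using \<open>s \<ge> 0\<close> by (simp add: ennreal_mult[symmetric] ennreal_numeral[symmetric] del: ennreal_numeral)
  ultimately show ?thesis by (simp add: ennreal_mult_le_mult_iff)
qed

lemma e_ran_lower: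
  fixes S :: "'a::real_normed_vector \<Rightarrow> 'b::real_normed_vector"
  assumes "bounded_linear S" "s \<ge> 0"
    and "\<And>x. ip (2 * k + 1) x x \<le> 1 \<Longrightarrow> p + (\<Sum>j<2 * k + 1. x j *\<^sub>R u j) \<in> F"
    and "\<And>z. s * sqrt (ip (2 * k + 1) z z) \<le> norm (S (\<Sum>j<2 * k + 1. z j *\<^sub>R u j))"
  shows "ennreal (12/25 * s) \<le> e_ran TYPE('c) k S F"
  unfolding e_ran_def
  using ran_err_lower[OF assms(1,2) refl assms(3,4)] by (intro INF_greatest) auto

subsection \<open>Greedy choice of differences\<close>

text \<open>Answering with \<open>S\<close> of a representative in \<open>F\<close> of the observed
  data is a non-adaptive method. Where its error exceeds \<open>2 * c\<close>, the input and its
  representative form the pair.\<close>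

lemma e_det_non_witness:
  fixes L :: "nat \<Rightarrow> 'a::real_normed_vector \<Rightarrow> real" and S :: "'a \<Rightarrow> 'b::real_normed_vector"
  assumes "ennreal (2 * c) < e_det_non n S F" "c \<ge> 0" "\<And>k. k < n \<Longrightarrow> bounded_linear (L k)"
  obtains f g where "f \<in> F" "g \<in> F" "\<And>k. k < n \<Longrightarrow> L k f = L k g" "2 * c < norm (S f - S g)"
proof -
  define N where "N f = map (\<lambda>k. L k f) [0..<n]" for f
  define h where "h y = (SOME g. g \<in> F \<and> N g = y)" for y
  have "(\<lambda>f. S (h (N f))) \<in> nonadaptive_algs n"
    unfolding nonadaptive_algs_def N_def using assms(3) 
    by (intro CollectI exI[of _ L] exI[of _ "\<lambda>y. S (h y)"] conjI) auto
  then have "e_det_non n S F \<le> det_err S F (\<lambda>f. S (h (N f)))"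
    unfolding e_det_non_def by (rule INF_lower)
  with assms(1) have "ennreal (2 * c) < det_err S F (\<lambda>f. S (h (N f)))" by (rule less_le_trans)
  then obtain f where f: "f \<in> F" "ennreal (2 * c) < ennreal (norm (S f - S (h (N f))))"
    unfolding det_err_def less_SUP_iff by blast
  have h: "h (N f) \<in> F \<and> N (h (N f)) = N f"
    unfolding h_def by (rule someI[of _ f]) (simp add: f)
  show ?thesis
  proof
    show "f \<in> F" "h (N f) \<in> F" using f h by auto
    show "2 * c < norm (S f - S (h (N f)))" using f(2) assms(2) by (simp add: ennreal_less_iff)
    show "L k f = L k (h (N f))" if "k < n" for k
      using h that unfolding N_def by (simp add: map_eq_conv)
  qed
qed

text \<open>Step \<open>j\<close> applies the witness lemma to the functionals generated by all
  earlier differences. The last step has \<open>N - 1\<close> predecessors with \<open>q\<close>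
  functionals each, whence the budget \<open>q * (N - 1)\<close>.\<close>

lemma greedy_differences:
  fixes S :: "'a::real_normed_vector \<Rightarrow> 'b::real_normed_vector" and T :: "nat \<Rightarrow> 'a \<Rightarrow> 'a \<Rightarrow> real"
  assumes "bounded_linear S" "ennreal (2 * c) < e_det_non n S F" "c \<ge> 0"
    and q: "q * (N - 1) \<le> n" and T: "\<And>l d. bounded_linear (T l d)"
  obtains f g where "\<And>j. j < N \<Longrightarrow> f j \<in> F" "\<And>j. j < N \<Longrightarrow> g j \<in> F"
    "\<And>j. j < N \<Longrightarrow> c < norm (S ((1/2) *\<^sub>R (f j - g j)))"
    "\<And>i j l. i < j \<Longrightarrow> j < N \<Longrightarrow> l < q \<Longrightarrow> T l ((1/2) *\<^sub>R (f i - g i)) ((1/2) *\<^sub>R (f j - g j)) = 0"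
proof -
  interpret S: bounded_linear S by fact
  define d where "d D i = (1/2) *\<^sub>R (fst (D i) - snd (D i))" for D :: "nat \<Rightarrow> 'a \<times> 'a" and i
  \<comment> \<open>The guard \<open>j < N\<close> drops the vanishing conditions beyond the budget,
    so that a choice exists for every \<open>j\<close>.\<close>
  define P where "P D j p \<longleftrightarrow> fst p \<in> F \<and> snd p \<in> F \<and> 2 * c < norm (S (fst p) - S (snd p)) \<and>
    (\<forall>i<j. \<forall>l<q. j < N \<longrightarrow> T l (d D i) (fst p) = T l (d D i) (snd p))" for D j p
  have "\<exists>D. \<forall>j. P D j (D j)"
  proof (rule dependent_wf_choice[of less_than])
    show "wf less_than" by simp
    show "P D j r = P D' j r" if "\<And>i. (i, j) \<in> less_than \<Longrightarrow> D i = D' i" for D D' j r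
      using that by (auto simp: P_def d_def)
    fix j D
    \<comment> \<open>Functional number \<open>i * q + l\<close> stands for the pair
      \<open>(i, l)\<close>, decoded by \<open>div\<close> and \<open>mod\<close>.\<close>
    obtain f g where fg: "f \<in> F" "g \<in> F"
      "\<And>k. k < n \<Longrightarrow> T (k mod q) (d D (k div q)) f = T (k mod q) (d D (k div q)) g" "2 * c < norm (S f - S g)"
      by (rule e_det_non_witness[OF assms(2,3), of "\<lambda>k. T (k mod q) (d D (k div q))"]) (use T in auto)
    have "T l (d D i) f = T l (d D i) g" if "i < j" "l < q" "j < N" for i l
    proof -
      have "i * q + l < Suc i * q" using that by simp
      also have "\<dots> \<le> (N - 1) * q" using that by (intro mult_le_mono1) simp
      also have "\<dots> \<le> n" using q by (simp add: mult.commute)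
      finally show ?thesis using fg(3)[of "i * q + l"] that by simp
    qed
    then show "\<exists>r. P D j r" using fg unfolding P_def by (intro exI[of _ "(f, g)"]) auto
  qed
  then obtain D where D: "\<And>j. P D j (D j)" by blast
  show ?thesis
  proof
    show "fst (D j) \<in> F" "snd (D j) \<in> F" for j using D[of j] by (auto simp: P_def)
    show "c < norm (S ((1/2) *\<^sub>R (fst (D j) - snd (D j))))" for j
      using D[of j] by (simp add: P_def S.scaleR S.diff)
    show "T l ((1/2) *\<^sub>R (fst (D i) - snd (D i))) ((1/2) *\<^sub>R (fst (D j) - snd (D j))) = 0"
      if "i < j" "j < N" "l < q" for i j l
    proof -
      interpret T: bounded_linear "T l (d D i)" by (rule T)
      have "T l (d D i) (fst (D j)) = T l (d D i) (snd (D j))" using D[of j] that by (simp add: P_def)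
      then have "T l (d D i) (d D j) = 0" by (simp add: d_def[of D j] T.scaleR T.diff)
      then show ?thesis by (simp add: d_def)
    qed
  qed
qed

section \<open>From a triangular system to the product of randomized errors\<close>

lemma prod_double: "(\<Prod>j<2 * n. f j) = (\<Prod>k<n. f (2 * k) * f (2 * k + 1))"
  for f :: "nat \<Rightarrow> 'a::comm_monoid_mult"
  by (induction n) (auto simp: algebra_simps)

lemma prod_ennreal_mono:
  fixes f g :: "'i \<Rightarrow> ennreal"
  shows "(\<And>i. i \<in> A \<Longrightarrow> f i \<le> g i) \<Longrightarrow> prod f A \<le> prod g A"
  by (induction A rule: infinite_finite_induct) (auto intro: mult_mono)

lemma enn_root_ge:
  assumes "ennreal (a ^ n) \<le> X" "n \<ge> 1" "a \<ge> 0"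
  shows "ennreal a \<le> enn_root n X"
proof (cases X)
  case (real r)
  then have "a ^ n \<le> r" using assms by (simp add: ennreal_le_iff)
  then have "root n (a ^ n) \<le> root n r" using assms(2) by (simp add: real_root_le_iff)
  then have "a \<le> root n r" using assms by (simp add: real_root_power_cancel)
  then show ?thesis using real by (simp add: enn_root_def ennreal_leI)
qed (simp add: enn_root_def)

text \<open>The geometry enters through two numbers only: \<rho> is the radius at which the
  Euclidean ball spanned by the \<open>d j\<close> fits into a translate of \<open>F\<close>, and
  \<beta> is the loss when norms in the target are bounded below by the Euclidean length of the
  functional values.\<close>

lemma triangular_system_bound:
  fixes S :: "'a::real_normed_vector \<Rightarrow> 'b::real_normed_vector"
  assumes S: "bounded_linear S" and n: "n \<ge> 1" and N: "N = 2 * n" and c: "c \<ge> 0"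
    and lam: "\<And>i. i < N \<Longrightarrow> bounded_linear (lam i)"
    and tri: "\<And>i j. i < j \<Longrightarrow> j < N \<Longrightarrow> lam i (S (d j)) = 0"
    and diag: "\<And>i. i < N \<Longrightarrow> c \<le> lam i (S (d i))"
    and rho: "\<rho> \<ge> 0" "\<And>x. ip N x x \<le> 1 \<Longrightarrow> p + \<rho> *\<^sub>R (\<Sum>j<N. x j *\<^sub>R d j) \<in> F"
    and beta: "\<beta> \<ge> 0" "\<And>y. \<beta> * sqrt (ip N (\<lambda>i. lam i y) (\<lambda>i. lam i y)) \<le> norm y"
  shows "ennreal (12/25 * \<rho> * \<beta> * c) \<le> enn_root n (\<Prod>k<n. e_ran TYPE('c) k S F)"
proof -
  interpret S: bounded_linear S by fact
  define M where "M i j = lam i (S (d j))" for i j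
  obtain v where on: "\<And>i j. i < N \<Longrightarrow> j < N \<Longrightarrow> ip N (v i) (v j) = (if i = j then 1 else 0)"
    and orth: "\<And>i j. i < N \<Longrightarrow> j < N \<Longrightarrow> i \<noteq> j \<Longrightarrow> ip N (mv N M (v i)) (mv N M (v j)) = 0"
    and dec: "\<And>i j. i \<le> j \<Longrightarrow> j < N \<Longrightarrow>
       ip N (mv N M (v j)) (mv N M (v j)) \<le> ip N (mv N M (v i)) (mv N M (v i))"
    using singular_vectors[of N M] by blast
  define t where "t j = ip N (mv N M (v j)) (mv N M (v j))" for j
  have t0: "0 \<le> t j" for j by (simp add: t_def ip_self_nonneg)
  have e: "ennreal (12/25 * (\<rho> * \<beta> * sqrt (t (2 * k)))) \<le> e_ran TYPE('c) k S F" if k: "k < n" for k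
  proof -
    define m where "m = 2 * k + 1"
    have mN: "m \<le> N" using k by (simp add: m_def N)
    define u where "u j = \<rho> *\<^sub>R (\<Sum>i<N. v j i *\<^sub>R d i)" for j
    \<comment> \<open>These are the coordinates of the embedded point with respect to the
      \<open>d i\<close>. Orthonormality of the \<open>v j\<close> makes \<open>w\<close> isometric,
      so the unit ball of dimension \<open>m\<close> stays in that of dimension
      \<open>N\<close>.\<close>
    define w where "w z = (\<lambda>i. \<Sum>j<m. z j * v j i)" for z
    have comb: "(\<Sum>j<m. z j *\<^sub>R u j) = \<rho> *\<^sub>R (\<Sum>i<N. w z i *\<^sub>R d i)" for z
    proof -
      have "(\<Sum>j<m. z j *\<^sub>R u j) = \<rho> *\<^sub>R (\<Sum>j<m. \<Sum>i<N. (z j * v j i) *\<^sub>R d i)"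
        by (simp add: u_def scaleR_sum_right mult_ac)
      also have "(\<Sum>j<m. \<Sum>i<N. (z j * v j i) *\<^sub>R d i) = (\<Sum>i<N. \<Sum>j<m. (z j * v j i) *\<^sub>R d i)"
        by (rule sum.swap)
      finally show ?thesis by (simp add: w_def scaleR_sum_left)
    qed
    have ww: "ip N (w z) (w z) = ip m z z" for z
    proof -
      have "ip N (w z) (w z) = (\<Sum>j<m. (z j)\<^sup>2 * 1)"
        unfolding w_def by (rule ip_combination) (use on mN in auto)
      then show ?thesis by (simp add: ip_def power2_eq_square)
    qed
    have "ennreal (12/25 * (\<rho> * \<beta> * sqrt (t (2 * k)))) \<le> e_ran TYPE('c) k S F"
    proof (rule e_ran_lower[OF S, of _ _ p u])
      show "p + (\<Sum>j<2 * k + 1. x j *\<^sub>R u j) \<in> F" if "ip (2 * k + 1) x x \<le> 1" for x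
        using rho(2)[of "w x"] that
        unfolding comb[unfolded m_def] ww[unfolded m_def] by blast
      fix z
      define y where "y = S (\<Sum>j<2 * k + 1. z j *\<^sub>R u j)"
      have lam_y: "lam i y = \<rho> * mv N M (w z) i" if i: "i < N" for i
      proof -
        interpret lam: bounded_linear "lam i" by (rule lam[OF i])
        show ?thesis
          unfolding y_def comb[unfolded m_def] by (simp add: S.scaleR S.sum lam.scaleR lam.sum mv_def M_def mult.commute)
      qed
      have "mv N M (w z) = (\<lambda>i. \<Sum>j<m. z j * mv N M (v j) i)"
        unfolding w_def by (simp add: mv_sum mv_scale)
      moreover have "ip N (\<lambda>i. \<Sum>j<m. z j * mv N M (v j) i) (\<lambda>i. \<Sum>j<m. z j * mv N M (v j) i)
          = (\<Sum>j<m. (z j)\<^sup>2 * t j)"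
      proof (rule ip_combination)
        fix i j assume "i < m" "j < m"
        then show "ip N (mv N M (v i)) (mv N M (v j)) = (if i = j then t i else 0)"
          using orth[of i j] mN by (cases "i = j") (auto simp: t_def)
      qed
      ultimately have "ip N (mv N M (w z)) (mv N M (w z)) = (\<Sum>j<m. (z j)\<^sup>2 * t j)" by (simp only:)
      \<comment> \<open>Among the first \<open>2 * k + 1\<close> squared singular values,
        \<open>t (2 * k)\<close> is the smallest.\<close>
      also have "\<dots> \<ge> (\<Sum>j<m. (z j)\<^sup>2 * t (2 * k))"
        using dec mN by (intro sum_mono mult_left_mono) (auto simp: t_def m_def)
      finally have "t (2 * k) * ip m z z \<le> ip N (mv N M (w z)) (mv N M (w z))"
        by (simp add: ip_def sum_distrib_left power2_eq_square mult.commute)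
      then have "\<rho>\<^sup>2 * (t (2 * k) * ip m z z) \<le> \<rho>\<^sup>2 * ip N (mv N M (w z)) (mv N M (w z))"
        by (intro mult_left_mono) auto
      also have "\<dots> = ip N (\<lambda>i. lam i y) (\<lambda>i. lam i y)"
        unfolding ip_def sum_distrib_left by (intro sum.cong refl) (simp add: lam_y power2_eq_square)
      finally have "sqrt (\<rho>\<^sup>2 * (t (2 * k) * ip m z z)) \<le> sqrt (ip N (\<lambda>i. lam i y) (\<lambda>i. lam i y))" by simp
      then have "\<beta> * (\<rho> * (sqrt (t (2 * k)) * sqrt (ip m z z))) \<le> \<beta> * sqrt (ip N (\<lambda>i. lam i y) (\<lambda>i. lam i y))"
        using beta(1) rho(1) by (intro mult_left_mono) (simp_all add: real_sqrt_mult)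
      also have "\<dots> \<le> norm y" by (rule beta(2))
      finally show "\<rho> * \<beta> * sqrt (t (2 * k)) * sqrt (ip (2 * k + 1) z z) \<le> norm (S (\<Sum>j<2 * k + 1. z j *\<^sub>R u j))"
        unfolding y_def[symmetric] by (simp add: m_def mult_ac)
    qed (use rho(1) beta(1) t0 in auto)
    then show ?thesis .
  qed
  \<comment> \<open>The \<open>t j\<close> are squared singular values with product at least
    \<open>c ^ (2 * N) = c ^ (4 * n)\<close>. Replacing each \<open>t (2 * k + 1)\<close> by the
    larger \<open>t (2 * k)\<close> leaves fourth powers, and the exponent \<open>Suc 3\<close> has
    the form in which it can be cancelled.\<close>
  have cn: "c ^ n \<le> (\<Prod>k<n. sqrt (t (2 * k)))"
  proof (rule power_le_imp_le_base)
    have "c ^ N \<le> (\<Prod>j<N. M j j)"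
      using diag c prod_mono[of "{..<N}" "\<lambda>_. c" "\<lambda>j. M j j"] by (simp add: M_def)
    then have "(c ^ N)\<^sup>2 \<le> (\<Prod>j<N. M j j)\<^sup>2" using c by (intro power_mono) auto
    also have "\<dots> = (\<Prod>j<N. t j)"
      unfolding t_def by (rule prod_singular_values[OF on orth, symmetric]) (auto simp: M_def tri)
    also have "\<dots> = (\<Prod>k<n. t (2 * k) * t (2 * k + 1))" unfolding N by (rule prod_double)
    also have "\<dots> \<le> (\<Prod>k<n. sqrt (t (2 * k)) ^ 4)"
    proof (rule prod_mono, intro conjI)
      fix k assume "k \<in> {..<n}"
      then have "t (2 * k + 1) \<le> t (2 * k)" unfolding t_def using N by (intro dec) auto
      then have "t (2 * k) * t (2 * k + 1) \<le> t (2 * k) * t (2 * k)" using t0 by (intro mult_left_mono) auto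
      also have "\<dots> = sqrt (t (2 * k)) ^ 4"
        using t0[of "2 * k"] by (simp add: power4_eq_xxxx mult.assoc)
      finally show "t (2 * k) * t (2 * k + 1) \<le> sqrt (t (2 * k)) ^ 4" .
      show "0 \<le> t (2 * k) * t (2 * k + 1)" using t0 by simp
    qed
    also have "\<dots> = (\<Prod>k<n. sqrt (t (2 * k))) ^ Suc 3" by (simp add: prod_power_distrib)
    finally show "(c ^ n) ^ Suc 3 \<le> (\<Prod>k<n. sqrt (t (2 * k))) ^ Suc 3"
      by (simp add: N power_mult[symmetric] mult.commute)
    show "0 \<le> (\<Prod>k<n. sqrt (t (2 * k)))" using t0 by (intro prod_nonneg) auto
  qed
  have "(12/25 * \<rho> * \<beta> * c) ^ n = (12/25 * \<rho> * \<beta>) ^ n * c ^ n" by (rule power_mult_distrib)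
  also have "\<dots> \<le> (12/25 * \<rho> * \<beta>) ^ n * (\<Prod>k<n. sqrt (t (2 * k)))"
    using cn rho(1) beta(1) by (intro mult_left_mono) auto
  also have "\<dots> = (\<Prod>k<n. 12/25 * (\<rho> * \<beta> * sqrt (t (2 * k))))"
    by (simp only: mult.assoc[symmetric] prod.distrib prod_constant card_lessThan power_mult_distrib)
  finally have "ennreal ((12/25 * \<rho> * \<beta> * c) ^ n) \<le> ennreal (\<Prod>k<n. 12/25 * (\<rho> * \<beta> * sqrt (t (2 * k))))"
    by (rule ennreal_leI)
  also have "\<dots> = (\<Prod>k<n. ennreal (12/25 * (\<rho> * \<beta> * sqrt (t (2 * k)))))"
    using rho(1) beta(1) t0 by (intro prod_ennreal[symmetric]) auto
  also have "\<dots> \<le> (\<Prod>k<n. e_ran TYPE('c) k S F)" by (rule prod_ennreal_mono) (use e in auto)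
  finally show ?thesis using n rho(1) beta(1) c by (intro enn_root_ge) auto
qed

text \<open>If the bound failed, a positive real \<open>b = 2 * c\<close> would lie strictly between
  both sides. Arguing with reals below \<open>E\<close> also covers an infinite
  \<open>E\<close>.\<close>

lemma ennreal_le_of_real_below:
  assumes "\<And>c. c > 0 \<Longrightarrow> ennreal (2 * c) < E \<Longrightarrow> ennreal (\<kappa> * c) \<le> R" "\<kappa> \<ge> 0" "K \<ge> 0" "2 \<le> K * \<kappa>"
  shows "E \<le> ennreal K * R"
proof (rule ccontr)
  assume "\<not> E \<le> ennreal K * R"
  then obtain y where y: "ennreal K * R < y" "y < E" by (metis dense not_le)
  then obtain b where b: "y = ennreal b" "b \<ge> 0" by (cases y) auto
  have "b > 0" using y(1) b by (metis ennreal_0 le_less not_less_zero)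
  have "ennreal (\<kappa> * (b / 2)) \<le> R" using assms(1)[of "b / 2"] y(2) b(1) \<open>b > 0\<close> by simp
  then have "ennreal K * ennreal (\<kappa> * (b / 2)) \<le> ennreal K * R" by (rule mult_left_mono) simp
  moreover have "b \<le> K * (\<kappa> * (b / 2))"
    using mult_right_mono[OF assms(4), of "b / 2"] b(2) by (simp add: mult.assoc)
  then have "ennreal b \<le> ennreal K * ennreal (\<kappa> * (b / 2))"
    using assms(2,3) by (simp add: ennreal_mult'[symmetric] ennreal_leI)
  ultimately have "y \<le> ennreal K * R" using b(1) by simp
  then show False using y(1) by simp
qed

text \<open>Common frame of all five cases. \<open>T 0\<close> pulls the functionals of \<Lambda>
  back along \<open>S\<close>, while \<open>T l\<close> for other \<open>l\<close> can impose extra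
  conditions on the differences. The ball condition may use all of them; the bound with \<beta> may
  use triangularity, as Bessel's inequality does.\<close>

lemma e_det_non_le:
  fixes S :: "'a::real_normed_vector \<Rightarrow> 'b::real_normed_vector"
    and \<Lambda> :: "'b \<Rightarrow> 'b \<Rightarrow> real" and T :: "nat \<Rightarrow> 'a \<Rightarrow> 'a \<Rightarrow> real"
  assumes S: "bounded_linear S" and n: "n \<ge> 1" and q: "q \<ge> 1" "q * (2 * n - 1) \<le> n'"
    and T: "\<And>l d. bounded_linear (T l d)" "\<And>d x. T 0 d x = \<Lambda> (S d) (S x)"
    and L: "\<And>y. bounded_linear (\<Lambda> y)" "\<And>y. \<Lambda> y y = norm y"
    and rho: "\<rho> \<ge> 0" "\<And>f g. (\<And>j. j < 2 * n \<Longrightarrow> f j \<in> F) \<Longrightarrow> (\<And>j. j < 2 * n \<Longrightarrow> g j \<in> F) \<Longrightarrow>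
      (\<And>i j l. i < j \<Longrightarrow> j < 2 * n \<Longrightarrow> l < q \<Longrightarrow> T l ((1/2) *\<^sub>R (f i - g i)) ((1/2) *\<^sub>R (f j - g j)) = 0) \<Longrightarrow>
      \<exists>p. \<forall>x. ip (2 * n) x x \<le> 1 \<longrightarrow> p + \<rho> *\<^sub>R (\<Sum>j<2 * n. x j *\<^sub>R ((1/2) *\<^sub>R (f j - g j))) \<in> F"
    and beta: "\<beta> \<ge> 0" "\<And>d y. (\<And>i j. i < j \<Longrightarrow> j < 2 * n \<Longrightarrow> \<Lambda> (d i) (d j) = 0) \<Longrightarrow>
      (\<And>j. j < 2 * n \<Longrightarrow> d j \<noteq> 0) \<Longrightarrow> \<beta> * sqrt (ip (2 * n) (\<lambda>i. \<Lambda> (d i) y) (\<lambda>i. \<Lambda> (d i) y)) \<le> norm y"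
    and K: "K \<ge> 0" "2 \<le> K * (12/25 * \<rho> * \<beta>)"
  shows "e_det_non n' S F \<le> ennreal K * enn_root n (\<Prod>k<n. e_ran TYPE('c) k S F)"
proof (rule ennreal_le_of_real_below[OF _ _ K])
  show "0 \<le> 12/25 * \<rho> * \<beta>" using rho(1) beta(1) by simp
  fix c :: real assume c: "c > 0" "ennreal (2 * c) < e_det_non n' S F"
  have "c \<ge> 0" using c by simp
  obtain f g where fg: "\<And>j. j < 2 * n \<Longrightarrow> f j \<in> F" "\<And>j. j < 2 * n \<Longrightarrow> g j \<in> F"
    "\<And>j. j < 2 * n \<Longrightarrow> c < norm (S ((1/2) *\<^sub>R (f j - g j)))"
    "\<And>i j l. i < j \<Longrightarrow> j < 2 * n \<Longrightarrow> l < q \<Longrightarrow> T l ((1/2) *\<^sub>R (f i - g i)) ((1/2) *\<^sub>R (f j - g j)) = 0"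
    by (rule greedy_differences[where T = T, OF S c(2) \<open>c \<ge> 0\<close> q(2) T(1)]) (rule that)
  define d where "d j = (1/2) *\<^sub>R (f j - g j)" for j
  obtain p where p: "\<And>x. ip (2 * n) x x \<le> 1 \<Longrightarrow> p + \<rho> *\<^sub>R (\<Sum>j<2 * n. x j *\<^sub>R d j) \<in> F"
    using rho(2)[of f g, OF fg(1) fg(2) fg(4)] unfolding d_def by blast
  have tri: "\<Lambda> (S (d i)) (S (d j)) = 0" if "i < j" "j < 2 * n" for i j
    using fg(4)[of i j 0] that q(1) by (simp add: d_def[symmetric] T(2))
  have pos: "c < norm (S (d j))" if "j < 2 * n" for j using fg(3)[OF that] by (simp add: d_def)
  show "ennreal (12/25 * \<rho> * \<beta> * c) \<le> enn_root n (\<Prod>k<n. e_ran TYPE('c) k S F)"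
  proof (rule triangular_system_bound[OF S n refl \<open>c \<ge> 0\<close>, where lam = "\<lambda>i. \<Lambda> (S (d i))" and d = d and p = p])
    show "\<beta> * sqrt (ip (2 * n) (\<lambda>i. \<Lambda> (S (d i)) y) (\<lambda>i. \<Lambda> (S (d i)) y)) \<le> norm y" for y
    proof (rule beta(2)[of "\<lambda>i. S (d i)"])
      show "S (d j) \<noteq> 0" if "j < 2 * n" for j using pos[OF that] c(1) by auto
    qed (use tri in auto)
    show "c \<le> \<Lambda> (S (d i)) (S (d i))" if "i < 2 * n" for i using pos[OF that] by (simp add: L(2))
  qed (use L(1) tri rho(1) beta(1) p in auto)
qed

section \<open>Euclidean balls inside the input set\<close>

text \<open>The centre is the average of the midpoints of \<open>f j\<close> and \<open>g j\<close>.
  Since \<open>|x j| \<le> 1\<close>, every summand stays on its segment, and averaging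
  \<open>N\<close> segments costs the factor \<open>1 / N\<close>.\<close>

lemma convex_embedding:
  assumes "convex F" "N \<ge> 1" "\<And>j. j < N \<Longrightarrow> f j \<in> F" "\<And>j. j < N \<Longrightarrow> g j \<in> F"
  shows "\<exists>p. \<forall>x. ip N x x \<le> 1 \<longrightarrow> p + (1 / real N) *\<^sub>R (\<Sum>j<N. x j *\<^sub>R ((1/2) *\<^sub>R (f j - g j))) \<in> F"
proof (intro exI allI impI)
  fix x assume x: "ip N x x \<le> 1"
  let ?p = "(\<Sum>j<N. (1 / real N) *\<^sub>R ((1/2) *\<^sub>R (f j + g j)))"
  have "(\<Sum>j<N. (1 / real N) *\<^sub>R (((1 + x j) / 2) *\<^sub>R f j + ((1 - x j) / 2) *\<^sub>R g j)) \<in> F"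
  proof (rule convex_sum[OF _ assms(1)])
    fix j assume "j \<in> {..<N}"
    then have "(x j)\<^sup>2 \<le> ip N x x"
      unfolding ip_def power2_eq_square by (intro member_le_sum[of j "{..<N}" "\<lambda>j. x j * x j"]) auto
    then have "(x j)\<^sup>2 \<le> 1" using x by linarith
    then have "\<bar>x j\<bar> \<le> 1" by (simp add: abs_square_le_1)
    then show "((1 + x j) / 2) *\<^sub>R f j + ((1 - x j) / 2) *\<^sub>R g j \<in> F"
      using \<open>j \<in> {..<N}\<close> assms(3,4) by (intro convexD[OF assms(1)]) (auto simp: field_simps)
  qed (use assms(2) in auto)
  also have "(\<Sum>j<N. (1 / real N) *\<^sub>R (((1 + x j) / 2) *\<^sub>R f j + ((1 - x j) / 2) *\<^sub>R g j))
      = (\<Sum>j<N. (1 / real N) *\<^sub>R ((1/2) *\<^sub>R (f j + g j)) + (1 / real N) *\<^sub>R (x j *\<^sub>R ((1/2) *\<^sub>R (f j - g j))))"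
  proof (intro sum.cong refl)
    fix j
    have "((1 + x j) / 2) *\<^sub>R f j + ((1 - x j) / 2) *\<^sub>R g j
        = (1/2) *\<^sub>R (f j + g j) + x j *\<^sub>R ((1/2) *\<^sub>R (f j - g j))"
      by (simp add: add_divide_distrib diff_divide_distrib scaleR_add_left scaleR_diff_left scaleR_add_right scaleR_diff_right)
    then show "(1 / real N) *\<^sub>R (((1 + x j) / 2) *\<^sub>R f j + ((1 - x j) / 2) *\<^sub>R g j)
      = (1 / real N) *\<^sub>R ((1/2) *\<^sub>R (f j + g j)) + (1 / real N) *\<^sub>R (x j *\<^sub>R ((1/2) *\<^sub>R (f j - g j)))"
      by (simp only: scaleR_add_right)
  qed
  also have "\<dots> = ?p + (1 / real N) *\<^sub>R (\<Sum>j<N. x j *\<^sub>R ((1/2) *\<^sub>R (f j - g j)))"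
    by (simp only: sum.distrib scaleR_sum_right)
  finally show "?p + (1 / real N) *\<^sub>R (\<Sum>j<N. x j *\<^sub>R ((1/2) *\<^sub>R (f j - g j))) \<in> F" .
qed

lemma sum_abs_le_sqrt_ip: "(\<Sum>i<N. \<bar>x i\<bar>) \<le> sqrt (real N) * sqrt (ip N x x)"
proof -
  have "(\<Sum>i<N. \<bar>x i\<bar> * \<bar>1\<bar>) \<le> L2_set x {..<N} * L2_set (\<lambda>_. 1) {..<N}"
    by (rule L2_set_mult_ineq)
  then show ?thesis by (simp add: L2_set_def ip_def power2_eq_square mult.commute)
qed

text \<open>By symmetry the half-differences and their negatives lie in \<open>F\<close>, so only
  the sum of the \<open>|x j|\<close> must be at most 1; Cauchy-Schwarz costs
  \<open>sqrt N\<close>.\<close>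

lemma symmetric_convex_embedding:
  assumes "convex F" "F = uminus ` F" "N \<ge> 1" "\<And>j. j < N \<Longrightarrow> f j \<in> F" "\<And>j. j < N \<Longrightarrow> g j \<in> F"
  shows "\<exists>p. \<forall>x. ip N x x \<le> 1 \<longrightarrow> p + (1 / sqrt (real N)) *\<^sub>R (\<Sum>j<N. x j *\<^sub>R ((1/2) *\<^sub>R (f j - g j))) \<in> F"
proof (intro exI[of _ 0] allI impI)
  fix x assume x: "ip N x x \<le> 1"
  define d where "d j = (1/2) *\<^sub>R (f j - g j)" for j
  have neg: "- y \<in> F" if "y \<in> F" for y using assms(2) that by blast
  have d: "d j \<in> F" if "j < N" for j
    using convexD[OF assms(1) assms(4)[OF that] neg[OF assms(5)[OF that]], of "1/2" "1/2"]
    by (simp add: d_def scaleR_diff_right)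
  have "0 \<in> F" using convexD[OF assms(1) d[of 0] neg[OF d[of 0]], of "1/2" "1/2"] assms(3) by simp
  define a where "a j = \<bar>x j\<bar> / sqrt (real N)" for j
  have a0: "0 \<le> a j" for j by (simp add: a_def)
  have "(\<Sum>j<N. a j) = (\<Sum>j<N. \<bar>x j\<bar>) / sqrt (real N)" by (simp add: a_def sum_divide_distrib)
  also have "\<dots> \<le> sqrt (ip N x x)"
    using sum_abs_le_sqrt_ip[of x N] assms(3) by (simp add: field_simps)
  also have "\<dots> \<le> 1" using x by simp
  finally have a1: "(\<Sum>j<N. a j) \<le> 1" .
  \<comment> \<open>The additional index \<open>N\<close> puts the remaining weight on the point
    0.\<close>
  define b where "b j = (if j < N then a j else 1 - (\<Sum>j<N. a j))" for j
  define e where "e j = (if j < N then sgn (x j) *\<^sub>R d j else 0)" for j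
  have "(\<Sum>j<Suc N. b j *\<^sub>R e j) \<in> F"
  proof (rule convex_sum[OF _ assms(1)])
    show "(\<Sum>j<Suc N. b j) = 1" by (simp add: b_def)
    show "0 \<le> b j" for j using a0 a1 by (simp add: b_def)
    show "e j \<in> F" if "j \<in> {..<Suc N}" for j
      using d[of j] neg[OF d[of j]] \<open>0 \<in> F\<close> by (auto simp: e_def sgn_real_def)
  qed simp
  also have "(\<Sum>j<Suc N. b j *\<^sub>R e j) = (\<Sum>j<N. (1 / sqrt (real N)) *\<^sub>R (x j *\<^sub>R d j))"
    by (simp add: b_def e_def a_def) (intro sum.cong refl, simp add: sgn_real_def)
  finally show "0 + (1 / sqrt (real N)) *\<^sub>R (\<Sum>j<N. x j *\<^sub>R ((1/2) *\<^sub>R (f j - g j))) \<in> F"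
    by (simp only: scaleR_sum_right d_def add_0_left)
qed

lemma orthogonal_norm_sum:
  fixes d :: "nat \<Rightarrow> 'a::real_inner"
  assumes "\<And>i j. i < j \<Longrightarrow> j < N \<Longrightarrow> inner (d i) (d j) = 0"
  shows "(norm (\<Sum>j<N. x j *\<^sub>R d j))\<^sup>2 = (\<Sum>j<N. (x j)\<^sup>2 * (norm (d j))\<^sup>2)"
  using assms
proof (induction N)
  case (Suc N)
  have "inner (\<Sum>j<N. x j *\<^sub>R d j) (x N *\<^sub>R d N) = 0"
    using Suc.prems by (simp add: inner_sum_left)
  then have "(norm ((\<Sum>j<N. x j *\<^sub>R d j) + x N *\<^sub>R d N))\<^sup>2
      = (norm (\<Sum>j<N. x j *\<^sub>R d j))\<^sup>2 + (norm (x N *\<^sub>R d N))\<^sup>2"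
    by (intro norm_add_Pythagorean) (simp add: real_inner_class.orthogonal_def)
  then show ?case using Suc by (simp add: power_mult_distrib)
qed simp

text \<open>The half-differences are orthogonal and of norm at most 1, so Pythagoras bounds the
  combination by the length of \<open>x\<close> without any loss.\<close>

lemma ball_embedding:
  fixes f g :: "nat \<Rightarrow> 'a::real_inner"
  assumes "\<And>j. j < N \<Longrightarrow> f j \<in> cball 0 1" "\<And>j. j < N \<Longrightarrow> g j \<in> cball 0 1"
    "\<And>i j. i < j \<Longrightarrow> j < N \<Longrightarrow> inner ((1/2) *\<^sub>R (f i - g i)) ((1/2) *\<^sub>R (f j - g j)) = 0"
  shows "\<exists>p. \<forall>x. ip N x x \<le> 1 \<longrightarrow> p + 1 *\<^sub>R (\<Sum>j<N. x j *\<^sub>R ((1/2) *\<^sub>R (f j - g j))) \<in> cball 0 1"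
proof (intro exI[of _ 0] allI impI)
  fix x assume x: "ip N x x \<le> 1"
  define d where "d j = (1/2) *\<^sub>R (f j - g j)" for j
  have "norm (d j) \<le> 1" if "j < N" for j
    using norm_triangle_ineq4[of "f j" "g j"] assms(1,2)[OF that] by (simp add: d_def)
  then have "(\<Sum>j<N. (x j)\<^sup>2 * (norm (d j))\<^sup>2) \<le> (\<Sum>j<N. (x j)\<^sup>2 * 1)"
    by (intro sum_mono mult_left_mono) (auto simp: power_le_one)
  also have "\<dots> \<le> 1" using x by (simp add: ip_def power2_eq_square)
  finally have "(norm (\<Sum>j<N. x j *\<^sub>R d j))\<^sup>2 \<le> 1"
    using orthogonal_norm_sum[of N d x] assms(3) by (simp add: d_def)
  then show "0 + 1 *\<^sub>R (\<Sum>j<N. x j *\<^sub>R ((1/2) *\<^sub>R (f j - g j))) \<in> cball 0 1"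
    by (simp add: d_def[symmetric] abs_square_le_1)
qed

section \<open>Euclidean bounds for norming functionals\<close>

definition norming :: "'b::real_normed_vector \<Rightarrow> 'b \<Rightarrow> real" where
  "norming y = (SOME l. bounded_linear l \<and> (\<forall>x. \<bar>l x\<bar> \<le> norm x) \<and> l y = norm y)"

lemma norming: "bounded_linear (norming y)" "\<bar>norming y x\<bar> \<le> norm x" "norming y y = norm y"
proof -
  obtain l where "bounded_linear l" "\<And>x. \<bar>l x\<bar> \<le> norm x" "l y = norm y"
    by (rule norming_functional[of y]) (rule that)
  then have "\<exists>l. bounded_linear l \<and> (\<forall>x. \<bar>l x\<bar> \<le> norm x) \<and> l y = norm y" by blast
  then have "bounded_linear (norming y) \<and> (\<forall>x. \<bar>norming y x\<bar> \<le> norm x) \<and> norming y y = norm y"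
    unfolding norming_def by (rule someI_ex)
  then show "bounded_linear (norming y)" "\<bar>norming y x\<bar> \<le> norm x" "norming y y = norm y" by auto
qed

lemma norming_l2_bound:
  assumes "N \<ge> 1"
  shows "1 / sqrt (real N) * sqrt (ip N (\<lambda>i. norming (d i) y) (\<lambda>i. norming (d i) y)) \<le> norm y"
proof -
  have "ip N (\<lambda>i. norming (d i) y) (\<lambda>i. norming (d i) y) \<le> (\<Sum>i<N. (norm y)\<^sup>2)"
    unfolding ip_def
  proof (rule sum_mono)
    fix i
    show "norming (d i) y * norming (d i) y \<le> (norm y)\<^sup>2"
      using power_mono[OF norming(2)[of "d i" y], of 2] by (simp add: power2_eq_square)
  qed
  then have "sqrt (ip N (\<lambda>i. norming (d i) y) (\<lambda>i. norming (d i) y)) \<le> sqrt (real N * (norm y)\<^sup>2)" by simp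
  then show ?thesis using assms by (simp add: real_sqrt_mult field_simps)
qed

text \<open>Symmetry of the inner product turns the one-sided triangular condition into full
  orthogonality of the \<open>sgn (d i)\<close>; the rest is Bessel's inequality.\<close>

lemma bessel_l2_bound:
  fixes d :: "nat \<Rightarrow> 'b::real_inner"
  assumes orth: "\<And>i j. i < j \<Longrightarrow> j < N \<Longrightarrow> inner (sgn (d i)) (d j) = 0" and nz: "\<And>j. j < N \<Longrightarrow> d j \<noteq> 0"
  shows "sqrt (ip N (\<lambda>i. inner (sgn (d i)) y) (\<lambda>i. inner (sgn (d i)) y)) \<le> norm y"
proof -
  define a where "a i = inner (sgn (d i)) y" for i
  have o: "inner (sgn (d i)) (sgn (d j)) = 0" if "i < j" "j < N" for i j
    using orth[OF that] by (simp add: sgn_div_norm)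
  let ?P = "\<Sum>i<N. a i *\<^sub>R sgn (d i)"
  have "(norm ?P)\<^sup>2 = (\<Sum>i<N. (a i)\<^sup>2 * (norm (sgn (d i)))\<^sup>2)"
    by (rule orthogonal_norm_sum) (rule o)
  also have "\<dots> = ip N a a" unfolding ip_def using nz by (intro sum.cong) (auto simp: norm_sgn power2_eq_square)
  finally have P: "inner ?P ?P = ip N a a" by (simp add: power2_norm_eq_inner)
  have "inner ?P y = ip N a a" by (simp add: inner_sum_left ip_def a_def)
  moreover have "0 \<le> inner (y - ?P) (y - ?P)" by simp
  ultimately have "ip N a a \<le> inner y y" using P
    by (simp add: inner_diff_left inner_diff_right inner_commute)
  then have "ip N a a \<le> (norm y)\<^sup>2" by (simp add: power2_norm_eq_inner)
  then show ?thesis unfolding a_def by (rule real_le_lsqrt[OF norm_ge_zero])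
qed

lemma norming_comp_bounded_linear:
  "bounded_linear S \<Longrightarrow> bounded_linear (\<lambda>x. norming y (S x))"
  by (rule bounded_linear_compose[OF norming(1)])

lemma inner_sgn_comp_bounded_linear:
  fixes S :: "'a::real_normed_vector \<Rightarrow> 'b::real_inner"
  shows "bounded_linear S \<Longrightarrow> bounded_linear (\<lambda>x. inner (sgn y) (S x))"
  by (rule bounded_linear_compose[OF bounded_linear_inner_right])

lemma inner_sgn_self: "inner (sgn y) y = norm (y :: 'b::real_inner)"
  by (cases "y = 0") (auto simp: sgn_div_norm power2_norm_eq_inner[symmetric] power2_eq_square)

section \<open>Numerical constants\<close>

text \<open>The value 36/25 is exactly what the general case tolerates, namely
  \<open>2 \<le> 72/25 / sqrt 2\<close>.\<close>

lemma sqrt2_le: "sqrt 2 \<le> 36/25"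
  by (rule real_le_lsqrt) (auto simp: power2_eq_square)

lemma powr_three_halves: "n \<ge> 1 \<Longrightarrow> real n powr (3/2) = real n * sqrt (real n)"
  using powr_add[of "real n" 1 "1/2"] by (simp add: powr_half_sqrt)

lemma constant_general:
  assumes "n \<ge> 1"
  shows "2 \<le> 12 * real n powr (3/2) * (12/25 * (1 / real (2 * n)) * (1 / sqrt (real (2 * n))))"
proof -
  have "12 * real n powr (3/2) * (12/25 * (1 / real (2 * n)) * (1 / sqrt (real (2 * n)))) = 72/25 / sqrt 2"
    using assms by (simp add: powr_three_halves real_sqrt_mult)
  moreover have "2 \<le> 72/25 / sqrt 2" using sqrt2_le by (simp add: field_simps)
  ultimately show ?thesis by simp
qed

lemma constant_symmetric:
  assumes "n \<ge> 1"
  shows "2 \<le> 12 * real n * (12/25 * (1 / sqrt (real (2 * n))) * (1 / sqrt (real (2 * n))))"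
proof -
  have eq: "(1 / sqrt (real (2 * n))) * (1 / sqrt (real (2 * n))) = 1 / real (2 * n)" by simp
  have "2 \<le> 12 * real n * (12/25 * (1 / real (2 * n)))" using assms by simp
  then show ?thesis by (simp only: mult.assoc eq)
qed

lemma constant_sqrt:
  assumes "n \<ge> 1"
  shows "2 \<le> 12 * real n powr (1/2) * (12/25 * (1 / sqrt (real (2 * n))))"
proof -
  have "12 * real n powr (1/2) * (12/25 * (1 / sqrt (real (2 * n)))) = 144/25 / sqrt 2"
    using assms by (simp add: powr_half_sqrt real_sqrt_mult)
  moreover have "2 \<le> 144/25 / sqrt 2" using sqrt2_le by (simp add: field_simps)
  ultimately show ?thesis by simp
qed

theorem theorem1:
  shows
  "(\<forall>(S :: 'a::banach \<Rightarrow> 'b::banach) F n. bounded_linear S \<and> convex F \<and> 1 \<le> n \<longrightarrow>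
      e_det_non (2*n - 1) S F \<le> ennreal (12 * real n powr (3/2)) *
        enn_root n (\<Prod>k<n. e_ran TYPE('c) k S F))
 \<and> (\<forall>(S :: 'a::banach \<Rightarrow> 'b::banach) F n. bounded_linear S \<and> convex F \<and> F = uminus ` F \<and> 1 \<le> n \<longrightarrow>
      e_det_non (2*n - 1) S F \<le> ennreal (12 * real n) *
        enn_root n (\<Prod>k<n. e_ran TYPE('c) k S F))
 \<and> (\<forall>(S :: 'a::banach \<Rightarrow> 'd::{real_inner, complete_space}) F n. bounded_linear S \<and> convex F \<and> 1 \<le> n \<longrightarrow>
      e_det_non (2*n - 1) S F \<le> ennreal (12 * real n) *
        enn_root n (\<Prod>k<n. e_ran TYPE('c) k S F))
 \<and> (\<forall>(S :: 'a::banach \<Rightarrow> 'd::{real_inner, complete_space}) F n.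
        bounded_linear S \<and> convex F \<and> F = uminus ` F \<and> 1 \<le> n \<longrightarrow>
      e_det_non (2*n - 1) S F \<le> ennreal (12 * real n powr (1/2)) *
        enn_root n (\<Prod>k<n. e_ran TYPE('c) k S F))
 \<and> (\<forall>(S :: 'e::{real_inner, complete_space} \<Rightarrow> 'b::banach) n. bounded_linear S \<and> 1 \<le> n \<longrightarrow>
      e_det_non (4*n - 1) S (cball 0 1) \<le> ennreal (12 * real n powr (1/2)) *
        enn_root n (\<Prod>k<n. e_ran TYPE('c) k S (cball 0 1)))"
proof (intro conjI allI impI; (elim conjE)?)
  fix S :: "'a \<Rightarrow> 'b" and F :: "'a set" and n :: nat
  assume S: "bounded_linear S" and F: "convex F" and n: "1 \<le> n"
  show "e_det_non (2*n - 1) S F \<le> ennreal (12 * real n powr (3/2)) *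
        enn_root n (\<Prod>k<n. e_ran TYPE('c) k S F)"
  \<comment> \<open>With \<open>N = 2 * n\<close>, a general convex set costs \<open>N\<close> and
    general norming functionals cost \<open>sqrt N\<close>. One functional per earlier difference
    needs \<open>2 * n - 1\<close> in all.\<close>
  proof (rule e_det_non_le[where \<Lambda> = norming and q = 1 and T = "\<lambda>l d x. norming (S d) (S x)"
        and \<rho> = "1 / real (2 * n)" and \<beta> = "1 / sqrt (real (2 * n))"])
    show "\<exists>p. \<forall>x. ip (2 * n) x x \<le> 1 \<longrightarrow> p + (1 / real (2 * n)) *\<^sub>R (\<Sum>j<2 * n. x j *\<^sub>R ((1/2) *\<^sub>R (f j - g j))) \<in> F"
      if "\<And>j. j < 2 * n \<Longrightarrow> f j \<in> F" "\<And>j. j < 2 * n \<Longrightarrow> g j \<in> F" for f g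
      by (rule convex_embedding[OF F _ that]) (use n in auto)
    show "1 / sqrt (real (2 * n)) * sqrt (ip (2 * n) (\<lambda>i. norming (d i) y) (\<lambda>i. norming (d i) y)) \<le> norm y"
      for d and y :: 'b by (rule norming_l2_bound) (use n in auto)
  qed (use S n constant_general[OF n] in \<open>simp_all add: norming norming_comp_bounded_linear\<close>)
next
  fix S :: "'a \<Rightarrow> 'b" and F :: "'a set" and n :: nat
  assume S: "bounded_linear S" and F: "convex F" "F = uminus ` F" and n: "1 \<le> n"
  show "e_det_non (2*n - 1) S F \<le> ennreal (12 * real n) *
        enn_root n (\<Prod>k<n. e_ran TYPE('c) k S F)"
  \<comment> \<open>Symmetry improves the radius from \<open>1 / N\<close> to
    \<open>1 / sqrt N\<close>.\<close>
  proof (rule e_det_non_le[where \<Lambda> = norming and q = 1 and T = "\<lambda>l d x. norming (S d) (S x)"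
        and \<rho> = "1 / sqrt (real (2 * n))" and \<beta> = "1 / sqrt (real (2 * n))"])
    show "\<exists>p. \<forall>x. ip (2 * n) x x \<le> 1 \<longrightarrow> p + (1 / sqrt (real (2 * n))) *\<^sub>R (\<Sum>j<2 * n. x j *\<^sub>R ((1/2) *\<^sub>R (f j - g j))) \<in> F"
      if "\<And>j. j < 2 * n \<Longrightarrow> f j \<in> F" "\<And>j. j < 2 * n \<Longrightarrow> g j \<in> F" for f g
      by (rule symmetric_convex_embedding[OF F _ that]) (use n in auto)
    show "1 / sqrt (real (2 * n)) * sqrt (ip (2 * n) (\<lambda>i. norming (d i) y) (\<lambda>i. norming (d i) y)) \<le> norm y"
      for d and y :: 'b by (rule norming_l2_bound) (use n in auto)
    show "2 \<le> 12 * real n * (12/25 * (1 / sqrt (real (2 * n))) * (1 / sqrt (real (2 * n))))"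
      by (rule constant_symmetric[OF n])
  qed (use S n in \<open>simp_all add: norming norming_comp_bounded_linear\<close>)
next
  fix S :: "'a \<Rightarrow> 'd" and F :: "'a set" and n :: nat
  assume S: "bounded_linear S" and F: "convex F" and n: "1 \<le> n"
  show "e_det_non (2*n - 1) S F \<le> ennreal (12 * real n) *
        enn_root n (\<Prod>k<n. e_ran TYPE('c) k S F)"
  \<comment> \<open>In a Hilbert target the inner product with \<open>sgn y\<close> norms
    \<open>y\<close>, and Bessel's inequality allows \<beta> = 1.\<close>
  proof (rule e_det_non_le[where \<Lambda> = "\<lambda>y. inner (sgn y)" and q = 1 and T = "\<lambda>l d x. inner (sgn (S d)) (S x)"
        and \<rho> = "1 / real (2 * n)" and \<beta> = 1])
    show "\<exists>p. \<forall>x. ip (2 * n) x x \<le> 1 \<longrightarrow> p + (1 / real (2 * n)) *\<^sub>R (\<Sum>j<2 * n. x j *\<^sub>R ((1/2) *\<^sub>R (f j - g j))) \<in> F"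
      if "\<And>j. j < 2 * n \<Longrightarrow> f j \<in> F" "\<And>j. j < 2 * n \<Longrightarrow> g j \<in> F" for f g
      by (rule convex_embedding[OF F _ that]) (use n in auto)
    show "1 * sqrt (ip (2 * n) (\<lambda>i. inner (sgn (d i)) y) (\<lambda>i. inner (sgn (d i)) y)) \<le> norm y"
      if "\<And>i j. i < j \<Longrightarrow> j < 2 * n \<Longrightarrow> inner (sgn (d i)) (d j) = 0" "\<And>j. j < 2 * n \<Longrightarrow> d j \<noteq> 0"
      for d and y :: 'd using bessel_l2_bound[OF that] by simp
  qed (use S n in \<open>simp_all add: inner_sgn_self inner_sgn_comp_bounded_linear bounded_linear_inner_right\<close>)
next
  fix S :: "'a \<Rightarrow> 'd" and F :: "'a set" and n :: nat
  assume S: "bounded_linear S" and F: "convex F" "F = uminus ` F" and n: "1 \<le> n"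
  show "e_det_non (2*n - 1) S F \<le> ennreal (12 * real n powr (1/2)) *
        enn_root n (\<Prod>k<n. e_ran TYPE('c) k S F)"
  proof (rule e_det_non_le[where \<Lambda> = "\<lambda>y. inner (sgn y)" and q = 1 and T = "\<lambda>l d x. inner (sgn (S d)) (S x)"
        and \<rho> = "1 / sqrt (real (2 * n))" and \<beta> = 1])
    show "\<exists>p. \<forall>x. ip (2 * n) x x \<le> 1 \<longrightarrow> p + (1 / sqrt (real (2 * n))) *\<^sub>R (\<Sum>j<2 * n. x j *\<^sub>R ((1/2) *\<^sub>R (f j - g j))) \<in> F"
      if "\<And>j. j < 2 * n \<Longrightarrow> f j \<in> F" "\<And>j. j < 2 * n \<Longrightarrow> g j \<in> F" for f g
      by (rule symmetric_convex_embedding[OF F _ that]) (use n in auto)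
    show "1 * sqrt (ip (2 * n) (\<lambda>i. inner (sgn (d i)) y) (\<lambda>i. inner (sgn (d i)) y)) \<le> norm y"
      if "\<And>i j. i < j \<Longrightarrow> j < 2 * n \<Longrightarrow> inner (sgn (d i)) (d j) = 0" "\<And>j. j < 2 * n \<Longrightarrow> d j \<noteq> 0"
      for d and y :: 'd using bessel_l2_bound[OF that] by simp
  qed (use S n constant_sqrt[OF n] in \<open>simp_all add: inner_sgn_self inner_sgn_comp_bounded_linear bounded_linear_inner_right\<close>)
next
  fix S :: "'e \<Rightarrow> 'b" and n :: nat
  assume S: "bounded_linear S" and n: "1 \<le> n"
  show "e_det_non (4*n - 1) S (cball 0 1) \<le> ennreal (12 * real n powr (1/2)) *
        enn_root n (\<Prod>k<n. e_ran TYPE('c) k S (cball 0 1))"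
  \<comment> \<open>Two functionals per earlier difference, one norming its image and one testing
    orthogonality in the domain, need \<open>2 * (2 * n - 1) = 4 * n - 2\<close> measurements, which
    is within \<open>4 * n - 1\<close>.\<close>
  proof (rule e_det_non_le[where \<Lambda> = norming and q = 2
        and T = "\<lambda>l d x. if l = 0 then norming (S d) (S x) else inner d x"
        and \<rho> = 1 and \<beta> = "1 / sqrt (real (2 * n))"])
    show "\<exists>p. \<forall>x. ip (2 * n) x x \<le> 1 \<longrightarrow> p + 1 *\<^sub>R (\<Sum>j<2 * n. x j *\<^sub>R ((1/2) *\<^sub>R (f j - g j))) \<in> cball 0 1"
      if "\<And>j. j < 2 * n \<Longrightarrow> f j \<in> cball 0 1" "\<And>j. j < 2 * n \<Longrightarrow> g j \<in> cball 0 1"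
        and zero: "\<And>i j (l::nat). i < j \<Longrightarrow> j < 2 * n \<Longrightarrow> l < 2 \<Longrightarrow>
          (if l = 0 then norming (S ((1/2) *\<^sub>R (f i - g i))) (S ((1/2) *\<^sub>R (f j - g j)))
           else inner ((1/2) *\<^sub>R (f i - g i)) ((1/2) *\<^sub>R (f j - g j))) = 0"
      for f g :: "nat \<Rightarrow> 'e"
    proof (rule ball_embedding[OF that(1,2)])
      show "inner ((1/2) *\<^sub>R (f i - g i)) ((1/2) *\<^sub>R (f j - g j)) = 0" if "i < j" "j < 2 * n" for i j
        using zero[OF that, of 1] by simp
    qed
    show "bounded_linear (\<lambda>x. if l = 0 then norming (S d) (S x) else inner d x)" for l :: nat and d
      using norming_comp_bounded_linear[OF S] bounded_linear_inner_right by (cases "l = 0") auto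
    show "1 / sqrt (real (2 * n)) * sqrt (ip (2 * n) (\<lambda>i. norming (d i) y) (\<lambda>i. norming (d i) y)) \<le> norm y"
      for d and y :: 'b by (rule norming_l2_bound) (use n in auto)
  qed (use S n constant_sqrt[OF n] in \<open>simp_all add: norming\<close>)
qed

end
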